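(* Let $M$ be a proper quasi bi-slant submanifold of a cosymplectic manifold $(\bar M,\varphi,\xi,\eta,g)$, with $TM=\mathcal{D}\oplus\mathcal{D}_1\oplus\mathcal{D}_2\oplus\langle\xi\rangle$. The invariant distribution $\mathcal{D}$ defines a totally geodesic foliation (in the sense that $\bar\nabla_XY\in\Gamma(\mathcal{D})$ for all $X,Y\in\Gamma(\mathcal{D})$) if and only if $$g(\nabla_X\mathcal{T}Y,\mathcal{T}Z)=-g(h(X,\mathcal{T}Y),\mathcal{F}Z)$$ and $$\mathcal{F}\nabla_X\mathcal{T}Y+\mathcal{C}h(X,\mathcal{T}Y)\in\Gamma(TM)$$ (that is, this normal vector field vanishes) for all $X,Y\in\Gamma(\mathcal{D})$ and $Z\in\Gamma(\mathcal{D}_1\oplus\mathcal{D}_2)$.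
   Context: An almost contact metric manifold $(\bar M,\varphi,\xi,\eta,g)$ is an odd-dimensional smooth manifold with a $(1,1)$-tensor $\varphi$, a vector field $\xi$, a 1-form $\eta$ and a Riemannian metric $g$ such that $\varphi^2=-I+\eta\otimes\xi$, $\varphi\xi=0$, $\eta\circ\varphi=0$, $\eta(\xi)=1$, $g(\varphi X,\varphi Y)=g(X,Y)-\eta(X)\eta(Y)$, $\eta(X)=g(X,\xi)$. It is cosymplectic if $\bar\nabla\varphi=0$, where $\bar\nabla$ is the Levi-Civita connection of $g$; then also $\bar\nabla\xi=0$. Let $M$ be a Riemannian manifold isometrically immersed in $\bar M$ (induced metric also denoted $g$). The induced connection $\nabla$ and the second fundamental form $h$ are given by $\bar\nabla_XY=\nabla_XY+h(X,Y)$ for $X,Y\in\Gamma(TM)$. $M$ is a quasi bi-slant submanifold if $\xi$ is tangent to $M$ and there is an orthogonal decomposition $TM=\mathcal{D}\oplus\mathcal{D}_1\oplus\mathcal{D}_2\oplus\langle\xi\rangle$ into distributions such that: $\varphi\mathcal{D}=\mathcal{D}$ ($\mathcal{D}$ is invariant); $\varphi\mathcal{D}_1\perp\mathcal{D}_2$ and $\varphi\mathcal{D}_2\perp\mathcal{D}_1$; and for $i=1,2$ the distribution $\mathcal{D}_i$ is slant with slant angle $\theta_i$, i.e. for every $p\in M$ and every nonzero $X\in(\mathcal{D}_i)_p$ the angle between $\varphi X$ and $(\mathcal{D}_i)_p$ equals the constant $\theta_i$. It is proper if $\mathcal{D},\mathcal{D}_1,\mathcal{D}_2$ all have nonzero rank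 and $\theta_1,\theta_2\notin\{0,\frac{\pi}{2}\}$. For $X\in\Gamma(TM)$ write $\varphi X=\mathcal{T}X+\mathcal{F}X$, and for $V\in\Gamma(T^\perp M)$ write $\varphi V=\mathcal{B}V+\mathcal{C}V$, where $\mathcal{T}X,\mathcal{B}V$ are tangent and $\mathcal{F}X,\mathcal{C}V$ are normal to $M$. *)

theory Defs
  imports "HOL-Analysis.Analysis"
begin

section \<open>Smooth functions between Euclidean spaces\<close>

text \<open>Used for open \<open>S\<close> only: all iterated directional derivatives exist and are continuous.\<close>

primrec k_smooth_on :: "nat \<Rightarrow> 'a::real_normed_vector set \<Rightarrow> ('a \<Rightarrow> 'b::real_normed_vector) \<Rightarrow> bool"
  where
    "k_smooth_on 0 S f \<longleftrightarrow> continuous_on S f"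
  | "k_smooth_on (Suc k) S f \<longleftrightarrow>
       (\<forall>x\<in>S. f differentiable (at x)) \<and>
       (\<forall>v. k_smooth_on k S (\<lambda>x. frechet_derivative f (at x) v))"

definition smooth_on :: "'a::real_normed_vector set \<Rightarrow> ('a \<Rightarrow> 'b::real_normed_vector) \<Rightarrow> bool"
  where "smooth_on S f \<longleftrightarrow> (\<forall>k. k_smooth_on k S f)"


section \<open>Smooth manifolds and tangent vectors\<close>

text \<open>
  The points of a manifold are all the elements of a Hausdorff, second countable type. A chart is
  a pair of its domain and a coordinate map whose values outside the domain are irrelevant. The
  model space is a Euclidean space, so the dimension is \<open>DIM('e)\<close>. Atlases need not be maximal.
\<close>

type_synonym ('m, 'e) chart = "'m set \<times> ('m \<Rightarrow> 'e)"

definition chart_inv :: "('m, 'e) chart \<Rightarrow> 'e \<Rightarrow> 'm"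
  where "chart_inv c = inv_into (fst c) (snd c)"

definition smooth_atlas ::
    "('m::{t2_space, second_countable_topology}, 'e::euclidean_space) chart set \<Rightarrow> bool"
  where
    "smooth_atlas A \<longleftrightarrow>
       (\<Union>c\<in>A. fst c) = UNIV \<and>
       (\<forall>c\<in>A. open (fst c) \<and> open (snd c ` fst c) \<and>
          inj_on (snd c) (fst c) \<and>
          homeomorphism (fst c) (snd c ` fst c) (snd c) (chart_inv c)) \<and>
       (\<forall>c\<in>A. \<forall>d\<in>A. smooth_on (snd c ` (fst c \<inter> fst d)) (snd d \<circ> chart_inv c))"

definition charts_at :: "('m, 'e) chart set \<Rightarrow> 'm \<Rightarrow> ('m, 'e) chart set"
  where "charts_at A p = {c \<in> A. p \<in> fst c}"

definition smooth_fun_on ::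
    "('m::topological_space, 'e::euclidean_space) chart set \<Rightarrow> 'm set \<Rightarrow>
     ('m \<Rightarrow> 'b::real_normed_vector) \<Rightarrow> bool"
  where
    "smooth_fun_on A U h \<longleftrightarrow>
       open U \<and> (\<forall>c\<in>A. smooth_on (snd c ` (U \<inter> fst c)) (h \<circ> chart_inv c))"

text \<open>
  A tangent vector at \<open>p\<close> is the family of its components in all the charts around \<open>p\<close>,
  where the components in two charts are related by the derivative of the transition map
  (components in the other charts are set to \<open>0\<close>). The type below consists of all families of
  components; it is a real vector space, and the tangent spaces are subspaces of it.
\<close>

typedef ('m, 'e) tvec = "UNIV :: (('m, 'e) chart \<Rightarrow> 'e) set"
  morphisms comp Tvec
  by simp

lemma comp_Tvec [simp]: "comp (Tvec f) = f"
  by (simp add: Tvec_inverse)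

lemma tvec_eq_iff: "u = v \<longleftrightarrow> (\<forall>c. comp u c = comp v c)"
  by (metis comp_inject ext)

instantiation tvec :: (type, real_vector) real_vector
begin

definition "0 = Tvec (\<lambda>c. 0)"
definition "u + v = Tvec (\<lambda>c. comp u c + comp v c)"
definition "u - v = Tvec (\<lambda>c. comp u c - comp v c)"
definition "- v = Tvec (\<lambda>c. - comp v c)"
definition "r *\<^sub>R v = Tvec (\<lambda>c. r *\<^sub>R comp v c)"

instance
  by standard
    (simp_all add: tvec_eq_iff zero_tvec_def plus_tvec_def minus_tvec_def uminus_tvec_def
      scaleR_tvec_def algebra_simps)

end

definition tangent_space ::
    "('m, 'e::euclidean_space) chart set \<Rightarrow> 'm \<Rightarrow> ('m, 'e) tvec set"
  where
    "tangent_space A p = {v.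
       (\<forall>c. c \<notin> charts_at A p \<longrightarrow> comp v c = 0) \<and>
       (\<forall>c\<in>charts_at A p. \<forall>d\<in>charts_at A p.
          comp v d = frechet_derivative (snd d \<circ> chart_inv c) (at (snd c p)) (comp v c))}"

text \<open>The tangent vector at \<open>p\<close> with components \<open>x\<close> in the chart \<open>c\<close>; for a basis vector \<open>x\<close>,
  this is a coordinate vector field of \<open>c\<close>.\<close>

definition coord_vec ::
    "('m, 'e::euclidean_space) chart set \<Rightarrow> ('m, 'e) chart \<Rightarrow> 'e \<Rightarrow> 'm \<Rightarrow> ('m, 'e) tvec"
  where
    "coord_vec A c x p = Tvec (\<lambda>d.
       if d \<in> charts_at A p
       then frechet_derivative (snd d \<circ> chart_inv c) (at (snd c p)) x else 0)"

text \<open>The derivative at \<open>p\<close> of a vector-valued function \<open>h\<close> in the direction of the tangent vector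
  \<open>v\<close>. By the chain rule, the choice of the chart is immaterial.\<close>

definition tderiv ::
    "('m, 'e::euclidean_space) chart set \<Rightarrow> 'm \<Rightarrow> ('m, 'e) tvec \<Rightarrow>
     ('m \<Rightarrow> 'b::real_normed_vector) \<Rightarrow> 'b"
  where
    "tderiv A p v h =
       (let c = (SOME c. c \<in> charts_at A p)
        in frechet_derivative (h \<circ> chart_inv c) (at (snd c p)) (comp v c))"

definition smooth_map ::
    "('n::topological_space, 'd::euclidean_space) chart set \<Rightarrow>
     ('m::topological_space, 'e::euclidean_space) chart set \<Rightarrow> ('n \<Rightarrow> 'm) \<Rightarrow> bool"
  where
    "smooth_map B A f \<longleftrightarrow>
       continuous_on UNIV f \<and> (\<forall>c\<in>A. smooth_fun_on B (f -` fst c) (snd c \<circ> f))"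

definition differential ::
    "('n, 'd::euclidean_space) chart set \<Rightarrow> ('m, 'e::euclidean_space) chart set \<Rightarrow>
     ('n \<Rightarrow> 'm) \<Rightarrow> 'n \<Rightarrow> ('n, 'd) tvec \<Rightarrow> ('m, 'e) tvec"
  where
    "differential B A f p v = Tvec (\<lambda>c.
       if c \<in> charts_at A (f p) then tderiv B p v (snd c \<circ> f) else 0)"


section \<open>Tensor fields and distributions\<close>

definition smooth_vfield_on ::
    "('m::topological_space, 'e::euclidean_space) chart set \<Rightarrow> 'm set \<Rightarrow>
     ('m \<Rightarrow> ('m, 'e) tvec) \<Rightarrow> bool"
  where
    "smooth_vfield_on A U X \<longleftrightarrow>
       open U \<and> (\<forall>p\<in>U. X p \<in> tangent_space A p) \<and>
       (\<forall>c\<in>A. smooth_fun_on A (U \<inter> fst c) (\<lambda>p. comp (X p) c))"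

definition lie_bracket ::
    "('m, 'e::euclidean_space) chart set \<Rightarrow> ('m \<Rightarrow> ('m, 'e) tvec) \<Rightarrow> ('m \<Rightarrow> ('m, 'e) tvec) \<Rightarrow>
     'm \<Rightarrow> ('m, 'e) tvec"
  where
    "lie_bracket A X Y p = Tvec (\<lambda>c.
       if c \<in> charts_at A p
       then tderiv A p (X p) (\<lambda>q. comp (Y q) c) - tderiv A p (Y p) (\<lambda>q. comp (X q) c)
       else 0)"

definition linear_from :: "'a::real_vector set \<Rightarrow> ('a \<Rightarrow> 'b::real_vector) \<Rightarrow> bool"
  where
    "linear_from S f \<longleftrightarrow>
       (\<forall>u\<in>S. \<forall>v\<in>S. f (u + v) = f u + f v) \<and> (\<forall>r. \<forall>u\<in>S. f (r *\<^sub>R u) = r *\<^sub>R f u)"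

text \<open>For tensor fields, smoothness means smoothness of the components with respect to the
  coordinate vector fields of every chart.\<close>

definition smooth_endomorphism ::
    "('m::topological_space, 'e::euclidean_space) chart set \<Rightarrow>
     ('m \<Rightarrow> ('m, 'e) tvec \<Rightarrow> ('m, 'e) tvec) \<Rightarrow> bool"
  where
    "smooth_endomorphism A P \<longleftrightarrow>
       (\<forall>p. linear_from (tangent_space A p) (P p) \<and>
            P p ` tangent_space A p \<subseteq> tangent_space A p) \<and>
       (\<forall>c\<in>A. \<forall>x. smooth_vfield_on A (fst c) (\<lambda>p. P p (coord_vec A c x p)))"

definition smooth_one_form ::
    "('m::topological_space, 'e::euclidean_space) chart set \<Rightarrow>
     ('m \<Rightarrow> ('m, 'e) tvec \<Rightarrow> real) \<Rightarrow> bool"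
  where
    "smooth_one_form A w \<longleftrightarrow>
       (\<forall>p. linear_from (tangent_space A p) (w p)) \<and>
       (\<forall>c\<in>A. \<forall>x. smooth_fun_on A (fst c) (\<lambda>p. w p (coord_vec A c x p)))"

definition riemannian_metric ::
    "('m::topological_space, 'e::euclidean_space) chart set \<Rightarrow>
     ('m \<Rightarrow> ('m, 'e) tvec \<Rightarrow> ('m, 'e) tvec \<Rightarrow> real) \<Rightarrow> bool"
  where
    "riemannian_metric A g \<longleftrightarrow>
       (\<forall>p. \<forall>u\<in>tangent_space A p. linear_from (tangent_space A p) (g p u)) \<and>
       (\<forall>p. \<forall>u\<in>tangent_space A p. \<forall>v\<in>tangent_space A p. g p u v = g p v u) \<and>
       (\<forall>p. \<forall>u\<in>tangent_space A p. u \<noteq> 0 \<longrightarrow> 0 < g p u u) \<and>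
       (\<forall>c\<in>A. \<forall>x y. smooth_fun_on A (fst c)
          (\<lambda>p. g p (coord_vec A c x p) (coord_vec A c y p)))"

definition distribution ::
    "('m::topological_space, 'e::euclidean_space) chart set \<Rightarrow> nat \<Rightarrow>
     ('m \<Rightarrow> ('m, 'e) tvec set) \<Rightarrow> bool"
  where
    "distribution A r D \<longleftrightarrow>
       (\<forall>p. subspace (D p) \<and> D p \<subseteq> tangent_space A p \<and> dim (D p) = r) \<and>
       (\<forall>p. \<exists>U E. p \<in> U \<and> (\<forall>i<r. smooth_vfield_on A U (E i)) \<and>
          (\<forall>q\<in>U. D q = span ((\<lambda>i. E i q) ` {..<r})))"

definition sections ::
    "('m::topological_space, 'e::euclidean_space) chart set \<Rightarrow>
     ('m \<Rightarrow> ('m, 'e) tvec set) \<Rightarrow> ('m \<Rightarrow> ('m, 'e) tvec) set"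
  where "sections A D = {X. smooth_vfield_on A UNIV X \<and> (\<forall>p. X p \<in> D p)}"

definition dist_sum ::
    "('m \<Rightarrow> ('m, 'e::real_vector) tvec set) \<Rightarrow> ('m \<Rightarrow> ('m, 'e) tvec set) \<Rightarrow>
     'm \<Rightarrow> ('m, 'e) tvec set"
  where "dist_sum D E p = {u + v | u v. u \<in> D p \<and> v \<in> E p}"


section \<open>Connections\<close>

text \<open>
  A connection is given by the covariant derivatives \<open>nab p v Y\<close>, for \<open>v\<close> a tangent vector at \<open>p\<close>
  and \<open>Y\<close> a vector field that is smooth on some neighbourhood of \<open>p\<close>; thus
  \<open>(\<nabla>\<^sub>X Y)(p) = nab p (X p) Y\<close>. The Leibniz rule, for functions \<open>h\<close> that are smooth only near \<open>p\<close>,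
  implies that the value depends only on \<open>Y\<close> near \<open>p\<close>: take for \<open>h\<close> the indicator function of a
  neighbourhood of \<open>p\<close>.
\<close>

type_synonym ('m, 'e) connection =
  "'m \<Rightarrow> ('m, 'e) tvec \<Rightarrow> ('m \<Rightarrow> ('m, 'e) tvec) \<Rightarrow> ('m, 'e) tvec"

definition affine_connection ::
    "('m::topological_space, 'e::euclidean_space) chart set \<Rightarrow> ('m, 'e) connection \<Rightarrow> bool"
  where
    "affine_connection A nab \<longleftrightarrow>
       (\<forall>U Y. smooth_vfield_on A U Y \<longrightarrow>
          (\<forall>p\<in>U. linear_from (tangent_space A p) (\<lambda>v. nab p v Y) \<and>
                 (\<forall>v\<in>tangent_space A p. nab p v Y \<in> tangent_space A p))) \<and>
       (\<forall>U Y Z. smooth_vfield_on A U Y \<and> smooth_vfield_on A U Z \<longrightarrow>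
          (\<forall>p\<in>U. \<forall>v\<in>tangent_space A p. nab p v (\<lambda>q. Y q + Z q) = nab p v Y + nab p v Z)) \<and>
       (\<forall>U h Y. smooth_fun_on A U h \<and> smooth_vfield_on A U Y \<longrightarrow>
          (\<forall>p\<in>U. \<forall>v\<in>tangent_space A p.
             nab p v (\<lambda>q. h q *\<^sub>R Y q) = tderiv A p v h *\<^sub>R Y p + h p *\<^sub>R nab p v Y)) \<and>
       (\<forall>U X Y. smooth_vfield_on A U X \<and> smooth_vfield_on A U Y \<longrightarrow>
          smooth_vfield_on A U (\<lambda>p. nab p (X p) Y))"

definition levi_civita ::
    "('m::topological_space, 'e::euclidean_space) chart set \<Rightarrow>
     ('m \<Rightarrow> ('m, 'e) tvec \<Rightarrow> ('m, 'e) tvec \<Rightarrow> real) \<Rightarrow> ('m, 'e) connection \<Rightarrow> bool"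
  where
    "levi_civita A g nab \<longleftrightarrow>
       affine_connection A nab \<and>
       (\<forall>U X Y. smooth_vfield_on A U X \<and> smooth_vfield_on A U Y \<longrightarrow>
          (\<forall>p\<in>U. nab p (X p) Y - nab p (Y p) X = lie_bracket A X Y p)) \<and>
       (\<forall>U Y Z. smooth_vfield_on A U Y \<and> smooth_vfield_on A U Z \<longrightarrow>
          (\<forall>p\<in>U. \<forall>v\<in>tangent_space A p.
             tderiv A p v (\<lambda>q. g q (Y q) (Z q)) = g p (nab p v Y) (Z p) + g p (Y p) (nab p v Z)))"

text \<open>
  The pull-back connection: the covariant derivative at \<open>p\<close>, in the direction of a tangent vector
  \<open>v\<close> of the source manifold, of a vector field \<open>V\<close> along the map \<open>f\<close>, i.e. with
  \<open>V q\<close> tangent to the target manifold at \<open>f q\<close>. If \<open>V = \<Sum>\<^sub>b V\<^sub>b (E\<^sub>b \<circ> f)\<close> with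
  the coordinate frame \<open>E\<^sub>b\<close> of a chart around \<open>f p\<close>, it is
  \<open>\<Sum>\<^sub>b v(V\<^sub>b) E\<^sub>b + V\<^sub>b \<nabla>\<^bsub>df v\<^esub> E\<^sub>b\<close>, which does not depend on the chart.
  In particular it is \<open>\<nabla>\<^bsub>df v\<^esub> W\<close> whenever \<open>V = W \<circ> f\<close> for a vector field \<open>W\<close> of the target,
  which is the meaning of the derivative of a vector field of the target given only
  along an immersed submanifold.
\<close>

definition cov_along ::
    "('n, 'd::euclidean_space) chart set \<Rightarrow> ('m, 'e::euclidean_space) chart set \<Rightarrow>
     ('m, 'e) connection \<Rightarrow> ('n \<Rightarrow> 'm) \<Rightarrow>
     'n \<Rightarrow> ('n, 'd) tvec \<Rightarrow> ('n \<Rightarrow> ('m, 'e) tvec) \<Rightarrow> ('m, 'e) tvec"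
  where
    "cov_along B A nab f p v V =
       (let c = (SOME c. c \<in> charts_at A (f p)) in
        \<Sum>b\<in>Basis.
          tderiv B p v (\<lambda>q. comp (V q) c \<bullet> b) *\<^sub>R coord_vec A c b (f p) +
          (comp (V p) c \<bullet> b) *\<^sub>R nab (f p) (differential B A f p v) (coord_vec A c b))"


section \<open>Cosymplectic manifolds\<close>

record ('m, 'e) contact_structure =
  atlas :: "('m, 'e) chart set"
  phi :: "'m \<Rightarrow> ('m, 'e) tvec \<Rightarrow> ('m, 'e) tvec"
  xi :: "'m \<Rightarrow> ('m, 'e) tvec"
  eta :: "'m \<Rightarrow> ('m, 'e) tvec \<Rightarrow> real"
  metric :: "'m \<Rightarrow> ('m, 'e) tvec \<Rightarrow> ('m, 'e) tvec \<Rightarrow> real"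

definition almost_contact_metric_manifold ::
    "('m::{t2_space, second_countable_topology}, 'e::euclidean_space) contact_structure \<Rightarrow> bool"
  where
    "almost_contact_metric_manifold N \<longleftrightarrow>
       smooth_atlas (atlas N) \<and> odd (DIM('e)) \<and>
       smooth_endomorphism (atlas N) (phi N) \<and>
       smooth_vfield_on (atlas N) UNIV (xi N) \<and>
       smooth_one_form (atlas N) (eta N) \<and>
       riemannian_metric (atlas N) (metric N) \<and>
       (\<forall>p. phi N p (xi N p) = 0 \<and> eta N p (xi N p) = 1 \<and>
          (\<forall>u\<in>tangent_space (atlas N) p.
             phi N p (phi N p u) = - u + eta N p u *\<^sub>R xi N p \<and>
             eta N p (phi N p u) = 0 \<and>
             eta N p u = metric N p u (xi N p) \<and>
             (\<forall>v\<in>tangent_space (atlas N) p.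
                metric N p (phi N p u) (phi N p v) =
                  metric N p u v - eta N p u * eta N p v)))"

text \<open>The argument \<open>nab\<close> is the Levi-Civita connection of the metric. The last conjunct is
  \<open>(\<nabla>\<^sub>v \<phi>) Y = \<nabla>\<^sub>v (\<phi> Y) - \<phi> (\<nabla>\<^sub>v Y) = 0\<close>.\<close>

definition cosymplectic_manifold ::
    "('m::{t2_space, second_countable_topology}, 'e::euclidean_space) contact_structure \<Rightarrow>
     ('m, 'e) connection \<Rightarrow> bool"
  where
    "cosymplectic_manifold N nab \<longleftrightarrow>
       almost_contact_metric_manifold N \<and>
       levi_civita (atlas N) (metric N) nab \<and>
       (\<forall>U Y. smooth_vfield_on (atlas N) U Y \<longrightarrow>
          (\<forall>p\<in>U. \<forall>v\<in>tangent_space (atlas N) p.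
             nab p v (\<lambda>q. phi N q (Y q)) - phi N p (nab p v Y) = 0))"


section \<open>Isometrically immersed submanifolds\<close>

record ('n, 'd, 'm) immersed =
  satlas :: "('n, 'd) chart set"
  smetric :: "'n \<Rightarrow> ('n, 'd) tvec \<Rightarrow> ('n, 'd) tvec \<Rightarrow> real"
  imm :: "'n \<Rightarrow> 'm"

abbreviation Tan :: "('n, 'd::euclidean_space, 'm) immersed \<Rightarrow> 'n \<Rightarrow> ('n, 'd) tvec set"
  where "Tan M p \<equiv> tangent_space (satlas M) p"

abbreviation dimm ::
    "('n, 'd::euclidean_space, 'm) immersed \<Rightarrow> ('m, 'e::euclidean_space) contact_structure \<Rightarrow>
     'n \<Rightarrow> ('n, 'd) tvec \<Rightarrow> ('m, 'e) tvec"
  where "dimm M N p \<equiv> differential (satlas M) (atlas N) (imm M) p"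

abbreviation ambg ::
    "('n, 'd, 'm) immersed \<Rightarrow> ('m, 'e) contact_structure \<Rightarrow>
     'n \<Rightarrow> ('m, 'e) tvec \<Rightarrow> ('m, 'e) tvec \<Rightarrow> real"
  where "ambg M N p \<equiv> metric N (imm M p)"

definition isometric_immersion ::
    "('n::{t2_space, second_countable_topology}, 'd::euclidean_space,
      'm::{t2_space, second_countable_topology}) immersed \<Rightarrow>
     ('m, 'e::euclidean_space) contact_structure \<Rightarrow> bool"
  where
    "isometric_immersion M N \<longleftrightarrow>
       smooth_atlas (satlas M) \<and> riemannian_metric (satlas M) (smetric M) \<and>
       smooth_map (satlas M) (atlas N) (imm M) \<and>
       (\<forall>p. inj_on (dimm M N p) (Tan M p)) \<and>
       (\<forall>p. \<forall>u\<in>Tan M p. \<forall>v\<in>Tan M p.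
          smetric M p u v = ambg M N p (dimm M N p u) (dimm M N p v))"

text \<open>
  Vectors tangent to the submanifold \<open>M\<close> are elements of its own tangent spaces \<open>Tan M p\<close>; they are
  mapped to the ambient manifold \<open>N\<close> by the differential of the immersion. Normal vectors are
  vectors of \<open>N\<close>.
\<close>

definition tan_part ::
    "('n, 'd::euclidean_space, 'm) immersed \<Rightarrow> ('m, 'e::euclidean_space) contact_structure \<Rightarrow>
     'n \<Rightarrow> ('m, 'e) tvec \<Rightarrow> ('n, 'd) tvec"
  where
    "tan_part M N p w =
       (THE u. u \<in> Tan M p \<and> (\<forall>z\<in>Tan M p. ambg M N p (w - dimm M N p u) (dimm M N p z) = 0))"

definition nor_part ::
    "('n, 'd::euclidean_space, 'm) immersed \<Rightarrow> ('m, 'e::euclidean_space) contact_structure \<Rightarrow>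
     'n \<Rightarrow> ('m, 'e) tvec \<Rightarrow> ('m, 'e) tvec"
  where "nor_part M N p w = w - dimm M N p (tan_part M N p w)"

text \<open>The ambient derivative \<open>\<nabla>\<^sub>X Y\<close> of vector fields \<open>X\<close>, \<open>Y\<close> tangent to \<open>M\<close>; its tangential
  and normal parts are the induced connection and the second fundamental form (Gauss formula).\<close>

definition amb_conn ::
    "('n, 'd::euclidean_space, 'm) immersed \<Rightarrow> ('m, 'e::euclidean_space) contact_structure \<Rightarrow>
     ('m, 'e) connection \<Rightarrow> ('n \<Rightarrow> ('n, 'd) tvec) \<Rightarrow> ('n \<Rightarrow> ('n, 'd) tvec) \<Rightarrow> 'n \<Rightarrow> ('m, 'e) tvec"
  where
    "amb_conn M N nab X Y p =
       cov_along (satlas M) (atlas N) nab (imm M) p (X p) (\<lambda>q. dimm M N q (Y q))"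

definition ind_conn ::
    "('n, 'd::euclidean_space, 'm) immersed \<Rightarrow> ('m, 'e::euclidean_space) contact_structure \<Rightarrow>
     ('m, 'e) connection \<Rightarrow> ('n \<Rightarrow> ('n, 'd) tvec) \<Rightarrow> ('n \<Rightarrow> ('n, 'd) tvec) \<Rightarrow> 'n \<Rightarrow> ('n, 'd) tvec"
  where "ind_conn M N nab X Y p = tan_part M N p (amb_conn M N nab X Y p)"

definition sff ::
    "('n, 'd::euclidean_space, 'm) immersed \<Rightarrow> ('m, 'e::euclidean_space) contact_structure \<Rightarrow>
     ('m, 'e) connection \<Rightarrow> ('n \<Rightarrow> ('n, 'd) tvec) \<Rightarrow> ('n \<Rightarrow> ('n, 'd) tvec) \<Rightarrow> 'n \<Rightarrow> ('m, 'e) tvec"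
  where "sff M N nab X Y p = nor_part M N p (amb_conn M N nab X Y p)"

definition TT ::
    "('n, 'd::euclidean_space, 'm) immersed \<Rightarrow> ('m, 'e::euclidean_space) contact_structure \<Rightarrow>
     'n \<Rightarrow> ('n, 'd) tvec \<Rightarrow> ('n, 'd) tvec"
  where "TT M N p v = tan_part M N p (phi N (imm M p) (dimm M N p v))"

definition FF ::
    "('n, 'd::euclidean_space, 'm) immersed \<Rightarrow> ('m, 'e::euclidean_space) contact_structure \<Rightarrow>
     'n \<Rightarrow> ('n, 'd) tvec \<Rightarrow> ('m, 'e) tvec"
  where "FF M N p v = nor_part M N p (phi N (imm M p) (dimm M N p v))"

definition CC ::
    "('n, 'd::euclidean_space, 'm) immersed \<Rightarrow> ('m, 'e::euclidean_space) contact_structure \<Rightarrow>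
     'n \<Rightarrow> ('m, 'e) tvec \<Rightarrow> ('m, 'e) tvec"
  where "CC M N p w = nor_part M N p (phi N (imm M p) w)"


section \<open>Quasi bi-slant submanifolds\<close>

text \<open>The angle between a nonzero vector and a nonzero subspace, for an inner product \<open>g\<close>: the
  least angle between the vector and a nonzero vector of the subspace.\<close>

definition angle_to_subspace :: "('a::real_vector \<Rightarrow> 'a \<Rightarrow> real) \<Rightarrow> 'a \<Rightarrow> 'a set \<Rightarrow> real"
  where
    "angle_to_subspace g w S =
       (INF s\<in>S - {0}. arccos (g w s / (sqrt (g w w) * sqrt (g s s))))"

definition slant_distribution ::
    "('n, 'd::euclidean_space, 'm) immersed \<Rightarrow> ('m, 'e::euclidean_space) contact_structure \<Rightarrow>
     ('n \<Rightarrow> ('n, 'd) tvec set) \<Rightarrow> real \<Rightarrow> bool"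
  where
    "slant_distribution M N D \<theta> \<longleftrightarrow>
       (\<forall>p. \<forall>u\<in>D p. u \<noteq> 0 \<longrightarrow>
          angle_to_subspace (ambg M N p) (phi N (imm M p) (dimm M N p u)) (dimm M N p ` D p) = \<theta>)"

definition reeb_line ::
    "('n, 'd::euclidean_space, 'm) immersed \<Rightarrow> ('m, 'e::euclidean_space) contact_structure \<Rightarrow>
     'n \<Rightarrow> ('n, 'd) tvec set"
  where "reeb_line M N p = {u \<in> Tan M p. dimm M N p u \<in> span {xi N (imm M p)}}"

definition orthogonal_dist ::
    "('n, 'd::euclidean_space, 'm) immersed \<Rightarrow>
     ('n \<Rightarrow> ('n, 'd) tvec set) \<Rightarrow> ('n \<Rightarrow> ('n, 'd) tvec set) \<Rightarrow> bool"
  where "orthogonal_dist M D E \<longleftrightarrow> (\<forall>p. \<forall>u\<in>D p. \<forall>v\<in>E p. smetric M p u v = 0)"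

definition phi_orthogonal ::
    "('n, 'd::euclidean_space, 'm) immersed \<Rightarrow> ('m, 'e::euclidean_space) contact_structure \<Rightarrow>
     ('n \<Rightarrow> ('n, 'd) tvec set) \<Rightarrow> ('n \<Rightarrow> ('n, 'd) tvec set) \<Rightarrow> bool"
  where
    "phi_orthogonal M N D E \<longleftrightarrow>
       (\<forall>p. \<forall>u\<in>D p. \<forall>v\<in>E p. ambg M N p (phi N (imm M p) (dimm M N p u)) (dimm M N p v) = 0)"

text \<open>The numbers \<open>r\<close>, \<open>r1\<close>, \<open>r2\<close> are the ranks of the three distributions.\<close>

definition quasi_bi_slant ::
    "('n::{t2_space, second_countable_topology}, 'd::euclidean_space,
      'm::{t2_space, second_countable_topology}) immersed \<Rightarrow>
     ('m, 'e::euclidean_space) contact_structure \<Rightarrow>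
     nat \<Rightarrow> nat \<Rightarrow> nat \<Rightarrow>
     ('n \<Rightarrow> ('n, 'd) tvec set) \<Rightarrow> ('n \<Rightarrow> ('n, 'd) tvec set) \<Rightarrow> ('n \<Rightarrow> ('n, 'd) tvec set) \<Rightarrow>
     real \<Rightarrow> real \<Rightarrow> bool"
  where
    "quasi_bi_slant M N r r1 r2 D D1 D2 \<theta>1 \<theta>2 \<longleftrightarrow>
       isometric_immersion M N \<and>
       (\<forall>p. xi N (imm M p) \<in> dimm M N p ` Tan M p) \<and>
       distribution (satlas M) r D \<and>
       distribution (satlas M) r1 D1 \<and>
       distribution (satlas M) r2 D2 \<and>
       orthogonal_dist M D D1 \<and> orthogonal_dist M D D2 \<and> orthogonal_dist M D1 D2 \<and>
       orthogonal_dist M D (reeb_line M N) \<and>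
       orthogonal_dist M D1 (reeb_line M N) \<and>
       orthogonal_dist M D2 (reeb_line M N) \<and>
       (\<forall>p. Tan M p = dist_sum (dist_sum (dist_sum D D1) D2) (reeb_line M N) p) \<and>
       (\<forall>p. phi N (imm M p) ` dimm M N p ` D p = dimm M N p ` D p) \<and>
       phi_orthogonal M N D1 D2 \<and> phi_orthogonal M N D2 D1 \<and>
       slant_distribution M N D1 \<theta>1 \<and> slant_distribution M N D2 \<theta>2"

definition proper_quasi_bi_slant ::
    "('n::{t2_space, second_countable_topology}, 'd::euclidean_space,
      'm::{t2_space, second_countable_topology}) immersed \<Rightarrow>
     ('m, 'e::euclidean_space) contact_structure \<Rightarrow>
     ('n \<Rightarrow> ('n, 'd) tvec set) \<Rightarrow> ('n \<Rightarrow> ('n, 'd) tvec set) \<Rightarrow> ('n \<Rightarrow> ('n, 'd) tvec set) \<Rightarrow>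
     real \<Rightarrow> real \<Rightarrow> bool"
  where
    "proper_quasi_bi_slant M N D D1 D2 \<theta>1 \<theta>2 \<longleftrightarrow>
       (\<exists>r r1 r2. quasi_bi_slant M N r r1 r2 D D1 D2 \<theta>1 \<theta>2 \<and> r \<noteq> 0 \<and> r1 \<noteq> 0 \<and> r2 \<noteq> 0) \<and>
       \<theta>1 \<notin> {0, pi / 2} \<and> \<theta>2 \<notin> {0, pi / 2}"

text \<open>Membership in \<open>\<Gamma>(D)\<close> of the field \<open>\<nabla>\<^sub>X Y\<close> is pointwise, since this field is smooth.\<close>

definition totally_geodesic_foliation ::
    "('n::topological_space, 'd::euclidean_space, 'm) immersed \<Rightarrow>
     ('m, 'e::euclidean_space) contact_structure \<Rightarrow>
     ('m, 'e) connection \<Rightarrow> ('n \<Rightarrow> ('n, 'd) tvec set) \<Rightarrow> bool"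
  where
    "totally_geodesic_foliation M N nab D \<longleftrightarrow>
       (\<forall>X\<in>sections (satlas M) D. \<forall>Y\<in>sections (satlas M) D. \<forall>p.
          amb_conn M N nab X Y p \<in> dimm M N p ` D p)"

end

theory Submission
  imports Defs
begin

text \<open>
  For \<open>X, Y \<in> \<Gamma>(D)\<close> put \<open>a = \<nabla>\<^sub>X Y\<close>, the ambient derivative. Invariance of \<open>D\<close> gives \<open>T Y = \<phi> Y\<close>,
  and since \<open>\<phi>\<close> is parallel, \<open>\<nabla>\<^sub>X T Y = \<phi> a\<close>. Applying this twice and using \<open>\<phi>\<^sup>2 = -1\<close> on
  \<open>D\<close> yields \<open>\<phi>\<^sup>2 a = - a\<close>, hence \<open>\<eta>(a) = 0\<close>. Therefore the first condition reads
  \<open>0 = g(\<phi> a, \<phi> Z) = g(a, Z)\<close>, and the second one says that the normal part of \<open>\<phi>\<^sup>2 a = - a\<close>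
  vanishes. Together with \<open>\<eta>(a) = 0\<close> they say that \<open>a\<close> is tangent to \<open>M\<close> and orthogonal to
  \<open>D1\<close>, \<open>D2\<close> and \<open>\<xi>\<close>, that is, \<open>a\<close> lies in \<open>D\<close>. Testing pointwise needs global sections
  of \<open>D1\<close> and \<open>D2\<close> through given vectors, which come from bump functions.
\<close>

section \<open>Calculus of smooth functions\<close>

text \<open>Once \<phi> is known to commute with the ambient derivative of sections of
  \<open>D\<close>, the equivalence is pointwise linear algebra; the obstacle is that commutation.
  Parallelism of \<phi> is given for vector fields of the ambient manifold, whereas a section of
  \<open>D\<close>, pushed forward, is only a field along the immersion and need not be the
  restriction of an ambient field. Its derivative \<open>cov_along\<close> is an expression in the
  coordinate frame of a chosen chart. Parallelism is therefore applied to the coordinate fields of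
  that chart, and the components are recombined by the product rule. The second application is made
  to \<phi>Y as a field along the immersion, for which differentiability of the components at one
  point suffices.

  A second obstacle is that tangent spaces are subspaces of a large vector space without an inner
  product of its own, while \<open>tan_part\<close> is a definite description. Existence of the
  orthogonal projection is obtained in coordinates, uniqueness from positivity of the metric;
  additivity of the normal part follows from uniqueness.\<close>

lemma has_derivative_cong_open:
  assumes "open S" "x \<in> S" "\<And>y. y \<in> S \<Longrightarrow> f y = g y"
  shows "(f has_derivative F) (at x) \<longleftrightarrow> (g has_derivative F) (at x)"
  using has_derivative_transform_within_open[of f F x UNIV S g]
    has_derivative_transform_within_open[of g F x UNIV S f] assms by auto

lemma frechet_derivative_cong_open:
  assumes "open S" "x \<in> S" "\<And>y. y \<in> S \<Longrightarrow> f y = g y"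
  shows "frechet_derivative f (at x) = frechet_derivative g (at x)"
  unfolding frechet_derivative_def using has_derivative_cong_open[OF assms] by simp

lemma differentiable_cong_open:
  assumes "open S" "x \<in> S" "\<And>y. y \<in> S \<Longrightarrow> f y = g y"
  shows "f differentiable (at x) \<longleftrightarrow> g differentiable (at x)"
  unfolding differentiable_def using has_derivative_cong_open[OF assms] by simp

lemma frechet_derivative_eqI:
  "(f has_derivative F) (at x) \<Longrightarrow> frechet_derivative f (at x) = F"
  using frechet_derivative_at by metis

lemma has_derivative_frechet:
  "f differentiable (at x) \<Longrightarrow> (f has_derivative frechet_derivative f (at x)) (at x)"
  using frechet_derivative_works by blast

section \<open>Locality and closure properties of k-times differentiability\<close>

lemma k_smooth_on_cong:
  assumes "open S" "\<And>x. x \<in> S \<Longrightarrow> f x = g x"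
  shows "k_smooth_on k S f \<longleftrightarrow> k_smooth_on k S g"
  using assms
proof (induction k arbitrary: f g)
  case 0
  then show ?case by (auto cong: continuous_on_cong)
next
  case (Suc k)
  have "k_smooth_on k S (\<lambda>x. frechet_derivative f (at x) v) \<longleftrightarrow>
      k_smooth_on k S (\<lambda>x. frechet_derivative g (at x) v)" for v
    by (rule Suc.IH[OF Suc.prems(1)]) (metis Suc.prems frechet_derivative_cong_open)
  moreover have "f differentiable (at x) \<longleftrightarrow> g differentiable (at x)" if "x \<in> S" for x
    using differentiable_cong_open[OF Suc.prems(1) that] Suc.prems(2) by metis
  ultimately show ?case by simp
qed

text \<open>Permits an explicit formula in place of the choice operator
  \<open>frechet_derivative\<close>. The two agree on S only, which is enough because S is open and
  smoothness on an open set ignores values elsewhere.\<close>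

lemma k_smooth_on_SucI:
  assumes "open S" "\<And>x. x \<in> S \<Longrightarrow> (f has_derivative F x) (at x)"
    and "\<And>v. k_smooth_on k S (\<lambda>x. F x v)"
  shows "k_smooth_on (Suc k) S f"
proof -
  have "k_smooth_on k S (\<lambda>x. frechet_derivative f (at x) v)" for v
    using assms(3)[of v] k_smooth_on_cong[OF assms(1), of "\<lambda>x. frechet_derivative f (at x) v" "\<lambda>x. F x v"]
      frechet_derivative_eqI[OF assms(2)] by simp
  then show ?thesis using assms(2) by (auto simp: differentiable_def)
qed

lemma k_smooth_on_subset: "k_smooth_on k S f \<Longrightarrow> T \<subseteq> S \<Longrightarrow> k_smooth_on k T f"
  by (induction k arbitrary: f) (auto intro: continuous_on_subset)

lemma k_smooth_on_SucD: "k_smooth_on (Suc k) S f \<Longrightarrow> k_smooth_on k S f"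
proof (induction k arbitrary: f)
  case 0
  then show ?case
    by (auto intro!: continuous_at_imp_continuous_on differentiable_imp_continuous_within)
qed simp

lemma k_smooth_on_local:
  assumes "\<And>x. x \<in> S \<Longrightarrow> \<exists>U. open U \<and> x \<in> U \<and> k_smooth_on k U f"
  shows "k_smooth_on k S f"
  using assms
proof (induction k arbitrary: f)
  case 0
  have "isCont f x" if "x \<in> S" for x
    using 0[OF that] by (auto simp: continuous_on_eq_continuous_at)
  then show ?case by (simp add: continuous_at_imp_continuous_on)
next
  case (Suc k)
  then have "f differentiable (at x)" if "x \<in> S" for x using that by fastforce
  moreover have "k_smooth_on k S (\<lambda>x. frechet_derivative f (at x) v)" for v
    by (rule Suc.IH) (use Suc.prems in fastforce)
  ultimately show ?case by simp
qed

lemma k_smooth_on_const [simp]: "k_smooth_on k S (\<lambda>x. a)"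
proof (induction k arbitrary: a)
  case (Suc k)
  have "frechet_derivative (\<lambda>x. a) (at x) = (\<lambda>v. 0)" for x :: 'a
    by (rule frechet_derivative_eqI) simp
  then show ?case using Suc by simp
qed simp

lemma k_smooth_on_bounded_linear:
  assumes "open S" "bounded_linear L" "k_smooth_on k S f"
  shows "k_smooth_on k S (\<lambda>x. L (f x))"
  using assms(3)
proof (induction k arbitrary: f)
  case 0
  then show ?case by (auto intro: bounded_linear.continuous_on[OF assms(2)])
next
  case (Suc k)
  have d: "((\<lambda>x. L (f x)) has_derivative (\<lambda>v. L (frechet_derivative f (at x) v))) (at x)" if "x \<in> S" for x
    using Suc.prems that by (intro bounded_linear.has_derivative[OF assms(2)] has_derivative_frechet) auto
  show ?case
  proof (rule k_smooth_on_SucI[OF assms(1) d])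
    fix v
    show "k_smooth_on k S (\<lambda>x. L (frechet_derivative f (at x) v))"
      using Suc by simp
  qed
qed

lemma k_smooth_on_add:
  assumes "open S" "k_smooth_on k S f" "k_smooth_on k S g"
  shows "k_smooth_on k S (\<lambda>x. f x + g x)"
  using assms(2,3)
proof (induction k arbitrary: f g)
  case 0
  then show ?case by (auto intro: continuous_on_add)
next
  case (Suc k)
  have d: "((\<lambda>x. f x + g x) has_derivative
      (\<lambda>v. frechet_derivative f (at x) v + frechet_derivative g (at x) v)) (at x)" if "x \<in> S" for x
    using Suc.prems that by (intro has_derivative_add has_derivative_frechet) auto
  show ?case
  proof (rule k_smooth_on_SucI[OF assms(1) d])
    fix v
    show "k_smooth_on k S (\<lambda>x. frechet_derivative f (at x) v + frechet_derivative g (at x) v)"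
      using Suc by simp
  qed
qed

lemma k_smooth_on_sum:
  assumes "open S" "\<And>i. i \<in> I \<Longrightarrow> k_smooth_on k S (f i)"
  shows "k_smooth_on k S (\<lambda>x. \<Sum>i\<in>I. f i x)"
  using assms(2) by (induction I rule: infinite_finite_induct) (auto intro: k_smooth_on_add[OF assms(1)])

text \<open>Each term of the product rule keeps one factor undifferentiated, so the induction
  hypothesis needs order k of the factors as well as of their derivatives; hence the appeal to
  \<open>k_smooth_on_SucD\<close>.\<close>

lemma k_smooth_on_bilinear:
  assumes "open S" "bounded_bilinear P" "k_smooth_on k S f" "k_smooth_on k S g"
  shows "k_smooth_on k S (\<lambda>x. P (f x) (g x))"
  using assms(3,4)
proof (induction k arbitrary: f g)
  case 0
  then show ?case by (auto intro: bounded_bilinear.continuous_on[OF assms(2)])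
next
  case (Suc k)
  have d: "((\<lambda>x. P (f x) (g x)) has_derivative
      (\<lambda>v. P (f x) (frechet_derivative g (at x) v) + P (frechet_derivative f (at x) v) (g x))) (at x)"
    if "x \<in> S" for x
    using Suc.prems that
    by (intro bounded_bilinear.FDERIV[OF assms(2)] has_derivative_frechet) auto
  show ?case
  proof (rule k_smooth_on_SucI[OF assms(1) d])
    fix v
    have "k_smooth_on k S f" "k_smooth_on k S g"
      using Suc.prems k_smooth_on_SucD by blast+
    then show "k_smooth_on k S (\<lambda>x. P (f x) (frechet_derivative g (at x) v) +
        P (frechet_derivative f (at x) v) (g x))"
      using Suc by (intro k_smooth_on_add[OF assms(1)] Suc.IH) auto
  qed
qed

lemma linear_euclidean_expand:
  fixes L :: "'a::euclidean_space \<Rightarrow> 'b::real_vector"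
  assumes "linear L"
  shows "L x = (\<Sum>b\<in>Basis. (x \<bullet> b) *\<^sub>R L b)"
proof -
  have "L x = L (\<Sum>b\<in>Basis. (x \<bullet> b) *\<^sub>R b)" by (simp add: euclidean_representation)
  also have "\<dots> = (\<Sum>b\<in>Basis. (x \<bullet> b) *\<^sub>R L b)"
    by (simp add: linear_sum[OF assms] linear_scale[OF assms])
  finally show ?thesis .
qed

text \<open>The chain rule differentiates g in a direction that moves with x, while smoothness of g
  speaks of fixed directions. Expanding the direction over a basis of the middle space, which is
  Euclidean for this purpose, leaves products of a component of the derivative of f with a
  fixed-direction derivative of g, to which the induction hypothesis for arbitrary g
  applies.\<close>

lemma k_smooth_on_compose:
  fixes f :: "'a::real_normed_vector \<Rightarrow> 'b::euclidean_space"
    and g :: "'b \<Rightarrow> 'c::real_normed_vector"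
  assumes "open S" "k_smooth_on k T g" "k_smooth_on k S f" "f ` S \<subseteq> T"
  shows "k_smooth_on k S (\<lambda>x. g (f x))"
  using assms(2,3)
proof (induction k arbitrary: g)
  case 0
  then show ?case using assms(4) by (auto intro: continuous_on_compose2)
next
  case (Suc k)
  have diff: "f differentiable (at x)" "g differentiable (at (f x))" if "x \<in> S" for x
    using Suc.prems assms(4) that by auto
  have d: "((\<lambda>x. g (f x)) has_derivative
      (\<lambda>v. \<Sum>b\<in>Basis. (frechet_derivative f (at x) v \<bullet> b) *\<^sub>R
        frechet_derivative g (at (f x)) b)) (at x)" if "x \<in> S" for x
  proof -
    have "((\<lambda>x. g (f x)) has_derivative
        (\<lambda>v. frechet_derivative g (at (f x)) (frechet_derivative f (at x) v))) (at x)"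
      by (rule has_derivative_compose[OF has_derivative_frechet has_derivative_frechet]) (rule diff[OF that])+
    moreover have "(\<lambda>v. frechet_derivative g (at (f x)) (frechet_derivative f (at x) v)) =
        (\<lambda>v. \<Sum>b\<in>Basis. (frechet_derivative f (at x) v \<bullet> b) *\<^sub>R frechet_derivative g (at (f x)) b)"
      by (rule ext) (rule linear_euclidean_expand[OF linear_frechet_derivative[OF diff(2)[OF that]]])
    ultimately show ?thesis by (simp only:)
  qed
  show ?case
  proof (rule k_smooth_on_SucI[OF assms(1) d])
    fix v
    have "k_smooth_on k S (\<lambda>x. frechet_derivative g (at (f x)) b)" for b
      using Suc.prems by (intro Suc.IH k_smooth_on_SucD[OF Suc.prems(2)]) simp
    then show "k_smooth_on k S (\<lambda>x. \<Sum>b\<in>Basis. (frechet_derivative f (at x) v \<bullet> b) *\<^sub>R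
        frechet_derivative g (at (f x)) b)"
      using Suc.prems
      by (intro k_smooth_on_sum[OF assms(1)] k_smooth_on_bilinear[OF assms(1) bounded_bilinear_scaleR]
          k_smooth_on_bounded_linear[OF assms(1) bounded_linear_inner_left]) auto
  qed
qed

lemma k_smooth_on_ident: "open S \<Longrightarrow> k_smooth_on k S (\<lambda>x. x)"
proof (cases k)
  case (Suc l)
  have "frechet_derivative (\<lambda>x. x) (at x) = (\<lambda>v. v)" for x :: 'a
    by (rule frechet_derivative_eqI) simp
  then show ?thesis using Suc by simp
qed simp

section \<open>Bump functions on Euclidean space\<close>

text \<open>The classical flat function exp(-1/t), extended by zero. The powers of 1/t are included
  so that derivatives stay in the linear span of the family, which makes smoothness a plain
  induction over all n at once.\<close>

definition flat :: "nat \<Rightarrow> real \<Rightarrow> real"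
  where "flat n t = (if t > 0 then inverse t ^ n * exp (- inverse t) else 0)"

lemma flat_has_derivative:
  "(flat n has_real_derivative flat (n + 2) t - real n * flat (n + 1) t) (at t)"
proof -
  consider "t < 0" | "t = 0" | "t > 0" by linarith
  then show ?thesis
  proof cases
    case 1
    have "((\<lambda>t. 0) has_real_derivative 0) (at t)" by simp
    then have "(flat n has_real_derivative 0) (at t)"
      by (rule has_field_derivative_transform_within_open[where S = "{..<0}"])
        (use 1 in \<open>auto simp: flat_def\<close>)
    then show ?thesis using 1 by (simp add: flat_def)
  next
    case 2
    \<comment> \<open>With s = 1/h the right difference quotient is s^(n+1) / exp s, where s tends
      to infinity; on the left the quotient is identically 0.\<close>
    have "((\<lambda>h. flat n h / h) \<longlongrightarrow> 0) (at_right 0)"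
    proof (rule Lim_transform_eventually)
      show "((\<lambda>h. inverse h ^ (n + 1) / exp (inverse h)) \<longlongrightarrow> (0::real)) (at_right 0)"
        by (rule filterlim_compose[OF tendsto_power_div_exp_0 filterlim_inverse_at_top_right])
      show "\<forall>\<^sub>F h in at_right 0. inverse h ^ (n + 1) / exp (inverse h) = flat n h / h"
        by (rule eventually_at_right_less[of 0, THEN eventually_mono])
          (simp add: flat_def exp_minus divide_inverse)
    qed
    moreover have "((\<lambda>h. flat n h / h) \<longlongrightarrow> 0) (at_left 0)"
    proof (rule Lim_transform_eventually)
      show "((\<lambda>h. 0) \<longlongrightarrow> (0::real)) (at_left 0)" by simp
      show "\<forall>\<^sub>F h in at_left 0. 0 = flat n h / h"
        by (simp add: eventually_at_filter flat_def)
    qed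
    ultimately have "((\<lambda>h. flat n h / h) \<longlongrightarrow> 0) (at 0)"
      by (simp add: filterlim_split_at)
    then have "(flat n has_real_derivative 0) (at 0)"
      by (simp add: DERIV_def flat_def[of n 0])
    then show ?thesis using 2 by (simp add: flat_def)
  next
    case 3
    have "((\<lambda>t. inverse t ^ n * exp (- inverse t)) has_real_derivative
        inverse t ^ (n + 2) * exp (- inverse t) - real n * (inverse t ^ (n + 1) * exp (- inverse t))) (at t)"
      using 3
      by (auto intro!: derivative_eq_intros simp: power_add power2_eq_square field_simps)
        (cases n; simp add: field_simps)
    then have "(flat n has_real_derivative
        inverse t ^ (n + 2) * exp (- inverse t) - real n * (inverse t ^ (n + 1) * exp (- inverse t))) (at t)"
      by (rule has_field_derivative_transform_within_open[where S = "{0<..}"])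
        (use 3 in \<open>auto simp: flat_def\<close>)
    then show ?thesis using 3 by (simp add: flat_def)
  qed
qed

lemma k_smooth_flat: "k_smooth_on k UNIV (flat n)"
proof (induction k arbitrary: n)
  case 0
  then show ?case
    using flat_has_derivative DERIV_isCont by (fastforce intro: continuous_at_imp_continuous_on)
next
  case (Suc k)
  have d: "(flat n has_derivative (*) (flat (n + 2) t - real n * flat (n + 1) t)) (at t)" for t
    using flat_has_derivative has_field_derivative_def by blast
  have "k_smooth_on k UNIV (\<lambda>t. (flat (n + 2) t + (- real n) * flat (n + 1) t) * v)" for v
    by (intro k_smooth_on_bilinear[OF _ bounded_bilinear_mult] k_smooth_on_add Suc.IH) auto
  then show ?case
    using d by (auto simp: frechet_derivative_eqI[OF d] differentiable_def)
qed

lemma euclidean_bump: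
  fixes a :: "'a::euclidean_space"
  assumes "r > 0"
  obtains \<beta> :: "'a \<Rightarrow> real"
  where "\<And>k. k_smooth_on k UNIV \<beta>" "\<beta> a = 1" "\<And>x. x \<notin> cball a r \<Longrightarrow> \<beta> x = 0"
proof
  \<comment> \<open>Positive exactly on the open ball of radius r. The squared norm keeps it smooth
    at the centre, and the sums and products are spelled so that the closure rules match. The factor
    \<open>inverse (flat 0 (r^2))\<close> normalises the value at a to 1.\<close>
  let ?q = "\<lambda>x. r^2 + (- 1) * ((x + - a) \<bullet> (x + - a))"
  let ?\<beta> = "\<lambda>x. inverse (flat 0 (r^2)) * flat 0 (?q x)"
  have "k_smooth_on k UNIV ?q" for k
    by (intro k_smooth_on_add k_smooth_on_bilinear[OF _ bounded_bilinear_mult]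
        k_smooth_on_bilinear[OF _ bounded_bilinear_inner] k_smooth_on_ident k_smooth_on_const open_UNIV)
  then show "k_smooth_on k UNIV ?\<beta>" for k
    by (intro k_smooth_on_bilinear[OF _ bounded_bilinear_mult] k_smooth_on_const
        k_smooth_on_compose[OF open_UNIV k_smooth_flat]) auto
  show "?\<beta> a = 1" using assms by (simp add: flat_def)
  show "?\<beta> x = 0" if "x \<notin> cball a r" for x
  proof -
    have "r^2 \<le> (norm (x - a))^2"
      using that assms by (intro power_mono) (auto simp: dist_norm norm_minus_commute)
    then show ?thesis by (simp add: flat_def power2_norm_eq_inner)
  qed
qed

section \<open>Charts and tangent vectors\<close>

lemma comp_zero [simp]: "comp 0 c = 0"
  and comp_add [simp]: "comp (u + v) c = comp u c + comp v c"
  and comp_diff [simp]: "comp (u - v) c = comp u c - comp v c"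
  and comp_uminus [simp]: "comp (- v) c = - comp v c"
  and comp_scaleR [simp]: "comp (r *\<^sub>R v) c = r *\<^sub>R comp v c"
  by (simp_all add: zero_tvec_def plus_tvec_def minus_tvec_def uminus_tvec_def scaleR_tvec_def)

lemma comp_sum [simp]: "comp (sum f I) c = (\<Sum>i\<in>I. comp (f i) c)"
  by (induction I rule: infinite_finite_induct) auto

lemma atlas_open: "smooth_atlas A \<Longrightarrow> c \<in> A \<Longrightarrow> open (fst c)"
  by (auto simp: smooth_atlas_def)

lemma chart_inv_left: "smooth_atlas A \<Longrightarrow> c \<in> A \<Longrightarrow> p \<in> fst c \<Longrightarrow> chart_inv c (snd c p) = p"
  by (auto simp: smooth_atlas_def chart_inv_def)

lemma atlas_homeomorphism:
  "smooth_atlas A \<Longrightarrow> c \<in> A \<Longrightarrow> homeomorphism (fst c) (snd c ` fst c) (snd c) (chart_inv c)"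
  by (auto simp: smooth_atlas_def)

lemma open_chart_image:
  assumes "smooth_atlas A" "c \<in> A" "open U"
  shows "open (snd c ` (U \<inter> fst c))"
proof -
  have "openin (top_of_set (fst c)) (U \<inter> fst c)"
    using assms(3) by (subst inf_commute) (rule openin_open_Int)
  then have "openin (top_of_set (snd c ` fst c)) (snd c ` (U \<inter> fst c))"
    using homeomorphism_imp_open_map[OF atlas_homeomorphism[OF assms(1,2)]] by blast
  moreover have "open (snd c ` fst c)"
    using assms(1,2) by (auto simp: smooth_atlas_def)
  ultimately show ?thesis by (simp add: openin_open_eq)
qed

lemma charts_at_iff: "c \<in> charts_at A p \<longleftrightarrow> c \<in> A \<and> p \<in> fst c"
  by (simp add: charts_at_def)

lemma charts_at_ex:
  assumes "smooth_atlas A"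
  obtains c where "c \<in> charts_at A p"
proof -
  have "p \<in> (\<Union>c\<in>A. fst c)" using assms by (simp add: smooth_atlas_def)
  then show ?thesis using that by (auto simp: charts_at_def)
qed

lemma some_chart:
  assumes "smooth_atlas A"
  shows "(SOME c. c \<in> charts_at A p) \<in> charts_at A p"
  using charts_at_ex[OF assms] by (metis someI_ex)

lemma transition_smooth:
  "smooth_atlas A \<Longrightarrow> c \<in> A \<Longrightarrow> d \<in> A \<Longrightarrow>
    k_smooth_on k (snd c ` (fst c \<inter> fst d)) (snd d \<circ> chart_inv c)"
  by (auto simp: smooth_atlas_def smooth_on_def)

lemma tangent_spaceD:
  "v \<in> tangent_space A p \<Longrightarrow> c \<in> charts_at A p \<Longrightarrow> d \<in> charts_at A p \<Longrightarrow>
    comp v d = frechet_derivative (snd d \<circ> chart_inv c) (at (snd c p)) (comp v c)"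
  unfolding tangent_space_def by blast

lemma tangent_spaceI:
  "(\<And>c. c \<notin> charts_at A p \<Longrightarrow> comp v c = 0) \<Longrightarrow>
    (\<And>c d. c \<in> charts_at A p \<Longrightarrow> d \<in> charts_at A p \<Longrightarrow>
      comp v d = frechet_derivative (snd d \<circ> chart_inv c) (at (snd c p)) (comp v c)) \<Longrightarrow>
    v \<in> tangent_space A p"
  unfolding tangent_space_def by blast

lemma tangent_space_comp_zero: "v \<in> tangent_space A p \<Longrightarrow> c \<notin> charts_at A p \<Longrightarrow> comp v c = 0"
  unfolding tangent_space_def by blast

section \<open>Derivatives of functions along tangent vectors\<close>

definition tdifferentiable ::
    "('m, 'e::euclidean_space) chart set \<Rightarrow> 'm \<Rightarrow> ('m \<Rightarrow> 'b::real_normed_vector) \<Rightarrow> bool"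
  where "tdifferentiable A p h \<longleftrightarrow>
    (\<forall>c\<in>charts_at A p. (h \<circ> chart_inv c) differentiable (at (snd c p)))"

text \<open>The chain rule for h in the chart c precomposed with the transition map from d to c. The
  composite agrees with h in the chart d only on the image of the overlap, which is open.\<close>

lemma has_derivative_change_chart:
  assumes A: "smooth_atlas A" and c: "c \<in> charts_at A p" and d: "d \<in> charts_at A p"
    and h: "(h \<circ> chart_inv c has_derivative F) (at (snd c p))"
  shows "(h \<circ> chart_inv d has_derivative
    (\<lambda>u. F (frechet_derivative (snd c \<circ> chart_inv d) (at (snd d p)) u))) (at (snd d p))"
proof -
  have cd: "c \<in> A" "d \<in> A" "p \<in> fst c" "p \<in> fst d" using c d by (auto simp: charts_at_iff)
  have p: "chart_inv d (snd d p) = p" using chart_inv_left[OF A] cd by blast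
  have "(snd c \<circ> chart_inv d) differentiable (at (snd d p))"
    using transition_smooth[OF A cd(2,1), of "Suc 0"] cd by auto
  then have t: "(snd c \<circ> chart_inv d has_derivative
      frechet_derivative (snd c \<circ> chart_inv d) (at (snd d p))) (at (snd d p))"
    by (rule has_derivative_frechet)
  have "((\<lambda>x. (h \<circ> chart_inv c) ((snd c \<circ> chart_inv d) x)) has_derivative
      (\<lambda>u. F (frechet_derivative (snd c \<circ> chart_inv d) (at (snd d p)) u))) (at (snd d p))"
    by (rule has_derivative_compose[OF t]) (use h in \<open>simp add: p o_def\<close>)
  moreover have "open (snd d ` (fst c \<inter> fst d))"
    using open_chart_image[OF A cd(2) atlas_open[OF A cd(1)]] .
  ultimately show ?thesis
    by (rule has_derivative_transform_within_open)
      (use cd chart_inv_left[OF A cd(1)] chart_inv_left[OF A cd(2)] in auto)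
qed

text \<open>\<open>tderiv\<close> uses a chart picked by choice. The derivative of the transition
  map that arises from changing the chart is absorbed by the transformation rule of the components
  of v, so any chart at p may be used for the computation, and differentiability in one chart gives
  it in all.\<close>

lemma tderivI:
  assumes A: "smooth_atlas A" and c: "c \<in> charts_at A p"
    and h: "(h \<circ> chart_inv c has_derivative F) (at (snd c p))"
  shows tdifferentiableI: "tdifferentiable A p h"
    and tderiv_eqI: "v \<in> tangent_space A p \<Longrightarrow> tderiv A p v h = F (comp v c)"
proof -
  show "tdifferentiable A p h"
    using has_derivative_change_chart[OF A c _ h]
    by (auto simp: tdifferentiable_def differentiable_def)
  assume v: "v \<in> tangent_space A p"
  define d where "d = (SOME c. c \<in> charts_at A p)"
  have d: "d \<in> charts_at A p" unfolding d_def by (rule some_chart[OF A])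
  have "tderiv A p v h =
      F (frechet_derivative (snd c \<circ> chart_inv d) (at (snd d p)) (comp v d))"
    using frechet_derivative_eqI[OF has_derivative_change_chart[OF A c d h]]
    by (simp add: tderiv_def Let_def d_def)
  then show "tderiv A p v h = F (comp v c)"
    by (simp only: tangent_spaceD[OF v d c])
qed

lemma tdifferentiable_has_derivative:
  assumes "tdifferentiable A p h" "c \<in> charts_at A p"
  shows "(h \<circ> chart_inv c has_derivative frechet_derivative (h \<circ> chart_inv c) (at (snd c p))) (at (snd c p))"
  using assms has_derivative_frechet by (auto simp: tdifferentiable_def)

lemma tderiv_chart:
  assumes "smooth_atlas A" "c \<in> charts_at A p" "tdifferentiable A p h" "v \<in> tangent_space A p"
  shows "tderiv A p v h = frechet_derivative (h \<circ> chart_inv c) (at (snd c p)) (comp v c)"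
  using tderiv_eqI[OF assms(1,2) tdifferentiable_has_derivative[OF assms(3,2)] assms(4)] .

lemma tderiv_cong:
  assumes A: "smooth_atlas A" and U: "open U" "p \<in> U" and eq: "\<And>q. q \<in> U \<Longrightarrow> h q = k q"
  shows tdifferentiable_cong: "tdifferentiable A p h \<longleftrightarrow> tdifferentiable A p k"
    and tderiv_cong': "tderiv A p v h = tderiv A p v k"
proof -
  have c: "(h \<circ> chart_inv c) differentiable (at (snd c p)) \<longleftrightarrow> (k \<circ> chart_inv c) differentiable (at (snd c p))"
    "frechet_derivative (h \<circ> chart_inv c) (at (snd c p)) = frechet_derivative (k \<circ> chart_inv c) (at (snd c p))"
    if "c \<in> charts_at A p" for c
  proof -
    have c: "c \<in> A" "p \<in> fst c" using that by (auto simp: charts_at_iff)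
    have o: "open (snd c ` (U \<inter> fst c))" "snd c p \<in> snd c ` (U \<inter> fst c)"
      using open_chart_image[OF A c(1) U(1)] U c by auto
    have e: "(h \<circ> chart_inv c) y = (k \<circ> chart_inv c) y" if "y \<in> snd c ` (U \<inter> fst c)" for y
      using that eq chart_inv_left[OF A c(1)] by auto
    show "(h \<circ> chart_inv c) differentiable (at (snd c p)) \<longleftrightarrow> (k \<circ> chart_inv c) differentiable (at (snd c p))"
      by (rule differentiable_cong_open[OF o e])
    show "frechet_derivative (h \<circ> chart_inv c) (at (snd c p)) = frechet_derivative (k \<circ> chart_inv c) (at (snd c p))"
      by (rule frechet_derivative_cong_open[OF o e])
  qed
  show "tdifferentiable A p h \<longleftrightarrow> tdifferentiable A p k"
    using c(1) by (simp add: tdifferentiable_def)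
  show "tderiv A p v h = tderiv A p v k"
    using c(2)[OF some_chart[OF A]] by (simp add: tderiv_def Let_def)
qed

lemma tderiv_bounded_linear:
  assumes A: "smooth_atlas A" and L: "bounded_linear L" and h: "tdifferentiable A p h"
  shows tdifferentiable_bounded_linear: "tdifferentiable A p (\<lambda>q. L (h q))"
    and "v \<in> tangent_space A p \<Longrightarrow> tderiv A p v (\<lambda>q. L (h q)) = L (tderiv A p v h)"
proof -
  obtain c where c: "c \<in> charts_at A p" using charts_at_ex[OF A] .
  note d = bounded_linear.has_derivative[OF L tdifferentiable_has_derivative[OF h c]]
  have d': "((\<lambda>q. L (h q)) \<circ> chart_inv c has_derivative
      (\<lambda>x. L (frechet_derivative (h \<circ> chart_inv c) (at (snd c p)) x))) (at (snd c p))"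
    using d by (simp add: o_def)
  show "tdifferentiable A p (\<lambda>q. L (h q))" by (rule tderivI(1)[OF A c d'])
  assume "v \<in> tangent_space A p"
  then show "tderiv A p v (\<lambda>q. L (h q)) = L (tderiv A p v h)"
    using tderivI(2)[OF A c d'] tderiv_chart[OF A c h] by simp
qed

lemma tderiv_sum:
  assumes A: "smooth_atlas A" and h: "\<And>i. i \<in> I \<Longrightarrow> tdifferentiable A p (h i)"
  shows tdifferentiable_sum: "tdifferentiable A p (\<lambda>q. \<Sum>i\<in>I. h i q)"
    and "v \<in> tangent_space A p \<Longrightarrow> tderiv A p v (\<lambda>q. \<Sum>i\<in>I. h i q) = (\<Sum>i\<in>I. tderiv A p v (h i))"
proof -
  obtain c where c: "c \<in> charts_at A p" using charts_at_ex[OF A] .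
  have "((\<lambda>x. \<Sum>i\<in>I. (h i \<circ> chart_inv c) x) has_derivative
      (\<lambda>x. \<Sum>i\<in>I. frechet_derivative (h i \<circ> chart_inv c) (at (snd c p)) x)) (at (snd c p))"
    by (rule has_derivative_sum) (rule tdifferentiable_has_derivative[OF h c])
  then have d': "((\<lambda>q. \<Sum>i\<in>I. h i q) \<circ> chart_inv c has_derivative
      (\<lambda>x. \<Sum>i\<in>I. frechet_derivative (h i \<circ> chart_inv c) (at (snd c p)) x)) (at (snd c p))"
    by (simp add: o_def)
  show "tdifferentiable A p (\<lambda>q. \<Sum>i\<in>I. h i q)" by (rule tderivI(1)[OF A c d'])
  assume "v \<in> tangent_space A p"
  then show "tderiv A p v (\<lambda>q. \<Sum>i\<in>I. h i q) = (\<Sum>i\<in>I. tderiv A p v (h i))"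
    using tderivI(2)[OF A c d'] tderiv_chart[OF A c h] by simp
qed

lemma tderiv_scaleR:
  assumes A: "smooth_atlas A" and s: "tdifferentiable A p s" and h: "tdifferentiable A p h"
  shows tdifferentiable_scaleR: "tdifferentiable A p (\<lambda>q. s q *\<^sub>R h q)"
    and "v \<in> tangent_space A p \<Longrightarrow>
      tderiv A p v (\<lambda>q. s q *\<^sub>R h q) = s p *\<^sub>R tderiv A p v h + tderiv A p v s *\<^sub>R h p"
proof -
  obtain c where c: "c \<in> charts_at A p" using charts_at_ex[OF A] .
  have p: "chart_inv c (snd c p) = p" using chart_inv_left[OF A] c by (auto simp: charts_at_iff)
  have d': "((\<lambda>q. s q *\<^sub>R h q) \<circ> chart_inv c has_derivative
      (\<lambda>x. s p *\<^sub>R frechet_derivative (h \<circ> chart_inv c) (at (snd c p)) x +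
        frechet_derivative (s \<circ> chart_inv c) (at (snd c p)) x *\<^sub>R h p)) (at (snd c p))"
    using has_derivative_scaleR[OF tdifferentiable_has_derivative[OF s c] tdifferentiable_has_derivative[OF h c]]
    by (simp add: o_def p)
  show "tdifferentiable A p (\<lambda>q. s q *\<^sub>R h q)" by (rule tderivI(1)[OF A c d'])
  assume "v \<in> tangent_space A p"
  then show "tderiv A p v (\<lambda>q. s q *\<^sub>R h q) = s p *\<^sub>R tderiv A p v h + tderiv A p v s *\<^sub>R h p"
    using tderivI(2)[OF A c d'] tderiv_chart[OF A c s] tderiv_chart[OF A c h] by simp
qed

lemma tderiv_linear_from:
  assumes A: "smooth_atlas A" and h: "tdifferentiable A p h"
  shows "linear_from UNIV (\<lambda>v. tderiv A p v h)"
proof -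
  have "linear (frechet_derivative (h \<circ> chart_inv c) (at (snd c p)))" if "c \<in> charts_at A p" for c
    using h that linear_frechet_derivative by (auto simp: tdifferentiable_def)
  from this[OF some_chart[OF A]] show ?thesis
    by (simp add: linear_from_def tderiv_def Let_def linear_add linear_scale)
qed

section \<open>Smooth functions on a manifold\<close>

lemma smooth_fun_on_open: "smooth_fun_on A U h \<Longrightarrow> open U"
  by (simp add: smooth_fun_on_def)

lemma smooth_fun_onD:
  "smooth_fun_on A U h \<Longrightarrow> c \<in> A \<Longrightarrow> k_smooth_on k (snd c ` (U \<inter> fst c)) (h \<circ> chart_inv c)"
  by (simp add: smooth_fun_on_def smooth_on_def)

lemma smooth_fun_onI:
  "open U \<Longrightarrow> (\<And>c k. c \<in> A \<Longrightarrow> k_smooth_on k (snd c ` (U \<inter> fst c)) (\<lambda>x. h (chart_inv c x)))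
    \<Longrightarrow> smooth_fun_on A U h"
  by (simp add: smooth_fun_on_def smooth_on_def o_def)

lemma smooth_fun_on_tdifferentiable:
  assumes "smooth_fun_on A U h" "p \<in> U"
  shows "tdifferentiable A p h"
  unfolding tdifferentiable_def
proof
  fix c assume "c \<in> charts_at A p"
  then have "c \<in> A" "p \<in> fst c" by (auto simp: charts_at_iff)
  then show "(h \<circ> chart_inv c) differentiable (at (snd c p))"
    using smooth_fun_onD[OF assms(1), of c "Suc 0"] assms(2) by auto
qed

lemma smooth_fun_on_cong:
  assumes A: "smooth_atlas A" and h: "smooth_fun_on A U h" and eq: "\<And>q. q \<in> U \<Longrightarrow> h q = k q"
  shows "smooth_fun_on A U k"
proof (rule smooth_fun_onI)
  show U: "open U" using h by (rule smooth_fun_on_open)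
  fix c n assume c: "c \<in> A"
  show "k_smooth_on n (snd c ` (U \<inter> fst c)) (\<lambda>x. k (chart_inv c x))"
    using smooth_fun_onD[OF h c, of n] eq chart_inv_left[OF A c]
    by (subst k_smooth_on_cong[OF open_chart_image[OF A c U], of _ "h \<circ> chart_inv c"]) auto
qed

lemma smooth_fun_on_subset:
  assumes "smooth_fun_on A U h" "open V" "V \<subseteq> U"
  shows "smooth_fun_on A V h"
proof (rule smooth_fun_onI[OF assms(2)])
  fix c k assume "c \<in> A"
  from smooth_fun_onD[OF assms(1) this, of k]
  show "k_smooth_on k (snd c ` (V \<inter> fst c)) (\<lambda>x. h (chart_inv c x))"
    unfolding o_def by (rule k_smooth_on_subset) (use assms(3) in auto)
qed

lemma smooth_fun_on_local:
  assumes A: "smooth_atlas A" and "open U" and loc: "\<And>p. p \<in> U \<Longrightarrow> \<exists>V. p \<in> V \<and> smooth_fun_on A V h"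
  shows "smooth_fun_on A U h"
proof (rule smooth_fun_onI[OF assms(2)])
  fix c k assume c: "c \<in> A"
  show "k_smooth_on k (snd c ` (U \<inter> fst c)) (\<lambda>x. h (chart_inv c x))"
  proof (rule k_smooth_on_local)
    fix x assume "x \<in> snd c ` (U \<inter> fst c)"
    then obtain p where p: "p \<in> U" "p \<in> fst c" "x = snd c p" by auto
    then obtain V where V: "p \<in> V" "smooth_fun_on A V h" using loc by blast
    then show "\<exists>W. open W \<and> x \<in> W \<and> k_smooth_on k W (\<lambda>x. h (chart_inv c x))"
      using p open_chart_image[OF A c smooth_fun_on_open[OF V(2)]] smooth_fun_onD[OF V(2) c, of k]
      by (intro exI[of _ "snd c ` (V \<inter> fst c)"]) (auto simp: o_def)
  qed
qed

lemma smooth_fun_on_const: "open U \<Longrightarrow> smooth_fun_on A U (\<lambda>q. a)"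
  by (rule smooth_fun_onI) auto

lemma smooth_fun_on_bounded_linear:
  assumes A: "smooth_atlas A" and "bounded_linear L" and "smooth_fun_on A U h"
  shows "smooth_fun_on A U (\<lambda>q. L (h q))"
proof (rule smooth_fun_onI)
  show U: "open U" using assms(3) by (rule smooth_fun_on_open)
  fix c k assume "c \<in> A"
  then show "k_smooth_on k (snd c ` (U \<inter> fst c)) (\<lambda>x. L (h (chart_inv c x)))"
    using smooth_fun_onD[OF assms(3), of c k]
    by (intro k_smooth_on_bounded_linear[OF open_chart_image[OF A _ U] assms(2)]) (auto simp: o_def)
qed

lemma smooth_fun_on_scaleR:
  assumes A: "smooth_atlas A" and "smooth_fun_on A U s" and "smooth_fun_on A U h"
  shows "smooth_fun_on A U (\<lambda>q. s q *\<^sub>R h q)"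
proof (rule smooth_fun_onI)
  show U: "open U" using assms(3) by (rule smooth_fun_on_open)
  fix c k assume "c \<in> A"
  then show "k_smooth_on k (snd c ` (U \<inter> fst c)) (\<lambda>x. s (chart_inv c x) *\<^sub>R h (chart_inv c x))"
    using smooth_fun_onD[OF assms(3), of c k] smooth_fun_onD[OF assms(2), of c k]
    by (intro k_smooth_on_bilinear[OF open_chart_image[OF A _ U] bounded_bilinear_scaleR]) (auto simp: o_def)
qed

lemma smooth_fun_on_sum:
  assumes A: "smooth_atlas A" and "open U" and "\<And>i. i \<in> I \<Longrightarrow> smooth_fun_on A U (h i)"
  shows "smooth_fun_on A U (\<lambda>q. \<Sum>i\<in>I. h i q)"
proof (rule smooth_fun_onI[OF assms(2)])
  fix c k assume "c \<in> A"
  then show "k_smooth_on k (snd c ` (U \<inter> fst c)) (\<lambda>x. \<Sum>i\<in>I. h i (chart_inv c x))"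
    using smooth_fun_onD[OF assms(3), of _ c k]
    by (intro k_smooth_on_sum[OF open_chart_image[OF A _ assms(2)]]) (auto simp: o_def)
qed

section \<open>Tangent spaces and coordinate vectors\<close>

text \<open>One component determines a tangent vector: those in the other charts at p are
  transported from it, and all remaining ones are 0 by convention. Equations between tangent vectors
  can thus be checked in a single chart.\<close>

lemma tangent_eqI:
  assumes "u \<in> tangent_space A p" "v \<in> tangent_space A p" "c \<in> charts_at A p" "comp u c = comp v c"
  shows "u = v"
  unfolding tvec_eq_iff
proof
  fix d
  show "comp u d = comp v d"
  proof (cases "d \<in> charts_at A p")
    case True
    then show ?thesis
      using tangent_spaceD[OF assms(1,3) True] tangent_spaceD[OF assms(2,3) True] assms(4) by simp
  next
    case False
    then show ?thesis using assms by (simp add: tangent_space_comp_zero)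
  qed
qed

lemma transition_has_derivative:
  assumes "smooth_atlas A" "c \<in> charts_at A p" "d \<in> charts_at A p"
  shows "(snd d \<circ> chart_inv c has_derivative frechet_derivative (snd d \<circ> chart_inv c) (at (snd c p))) (at (snd c p))"
  using transition_smooth[OF assms(1), of c d "Suc 0"] assms(2,3)
  by (intro has_derivative_frechet) (auto simp: charts_at_iff)

lemma transition_linear:
  assumes "smooth_atlas A" "c \<in> charts_at A p" "d \<in> charts_at A p"
  shows "linear (frechet_derivative (snd d \<circ> chart_inv c) (at (snd c p)))"
  using has_derivative_linear[OF transition_has_derivative[OF assms]] .

lemma tangent_subspace:
  assumes "smooth_atlas A"
  shows "subspace (tangent_space A p)"
  unfolding subspace_def
proof (intro conjI ballI allI)
  show "0 \<in> tangent_space A p"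
    by (rule tangent_spaceI) (simp_all add: linear_0[OF transition_linear[OF assms]])
  fix u assume u: "u \<in> tangent_space A p"
  show "u + v \<in> tangent_space A p" if v: "v \<in> tangent_space A p" for v
    by (rule tangent_spaceI)
      (simp_all add: linear_add[OF transition_linear[OF assms]] tangent_space_comp_zero[OF u]
        tangent_space_comp_zero[OF v] flip: tangent_spaceD[OF u] tangent_spaceD[OF v])
  show "r *\<^sub>R u \<in> tangent_space A p" for r
    by (rule tangent_spaceI)
      (simp_all add: linear_scale[OF transition_linear[OF assms]] tangent_space_comp_zero[OF u]
        flip: tangent_spaceD[OF u])
qed

lemma comp_coord_vec:
  "d \<in> charts_at A p \<Longrightarrow>
    comp (coord_vec A c x p) d = frechet_derivative (snd d \<circ> chart_inv c) (at (snd c p)) x"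
  by (simp add: coord_vec_def)

lemma comp_coord_vec_self:
  assumes A: "smooth_atlas A" and c: "c \<in> charts_at A p"
  shows "comp (coord_vec A c x p) c = x"
proof -
  have c': "c \<in> A" "p \<in> fst c" using c by (auto simp: charts_at_iff)
  have "((\<lambda>x. x) has_derivative (\<lambda>x. x)) (at (snd c p))" by simp
  then have "(snd c \<circ> chart_inv c has_derivative (\<lambda>x. x)) (at (snd c p))"
    by (rule has_derivative_transform_within_open[where s = "snd c ` (UNIV \<inter> fst c)"])
      (use open_chart_image[OF A c'(1) open_UNIV] chart_inv_left[OF A c'(1)] c' in auto)
  then show ?thesis using comp_coord_vec[OF c] frechet_derivative_eqI by metis
qed

text \<open>Compatibility of the components is the cocycle identity for the derivatives of the
  transition maps, which is a change of chart applied to the coordinate map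
  \<open>snd d'\<close>.\<close>

lemma coord_vec_tangent:
  assumes A: "smooth_atlas A" and c: "c \<in> charts_at A p"
  shows "coord_vec A c x p \<in> tangent_space A p"
proof -
  have "comp (coord_vec A c x p) d' =
      frechet_derivative (snd d' \<circ> chart_inv d) (at (snd d p)) (comp (coord_vec A c x p) d)"
    if d: "d \<in> charts_at A p" and d': "d' \<in> charts_at A p" for d d'
    using frechet_derivative_eqI[OF has_derivative_change_chart[OF A d c transition_has_derivative[OF A d d']]]
    by (simp add: comp_coord_vec d d')
  moreover have "comp (coord_vec A c x p) d = 0" if "d \<notin> charts_at A p" for d
    using that by (simp add: coord_vec_def)
  ultimately show ?thesis by (intro tangent_spaceI)
qed

lemma tangent_expand:
  assumes A: "smooth_atlas A" and c: "c \<in> charts_at A p" and v: "v \<in> tangent_space A p"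
  shows "v = (\<Sum>b\<in>Basis. (comp v c \<bullet> b) *\<^sub>R coord_vec A c b p)"
proof (rule tangent_eqI[OF v _ c])
  show "(\<Sum>b\<in>Basis. (comp v c \<bullet> b) *\<^sub>R coord_vec A c b p) \<in> tangent_space A p"
    by (intro subspace_sum subspace_scale tangent_subspace[OF A] coord_vec_tangent[OF A c])
qed (simp add: comp_coord_vec_self[OF A c] euclidean_representation)

section \<open>Smooth vector fields\<close>

lemma smooth_vfield_on_open: "smooth_vfield_on A U X \<Longrightarrow> open U"
  by (simp add: smooth_vfield_on_def)

lemma smooth_vfield_on_tangent: "smooth_vfield_on A U X \<Longrightarrow> p \<in> U \<Longrightarrow> X p \<in> tangent_space A p"
  by (simp add: smooth_vfield_on_def)

lemma smooth_vfield_onD: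
  "smooth_vfield_on A U X \<Longrightarrow> c \<in> A \<Longrightarrow> smooth_fun_on A (U \<inter> fst c) (\<lambda>p. comp (X p) c)"
  by (simp add: smooth_vfield_on_def)

lemma smooth_vfield_on_cong:
  assumes A: "smooth_atlas A" and X: "smooth_vfield_on A U X" and eq: "\<And>q. q \<in> U \<Longrightarrow> X q = Y q"
  shows "smooth_vfield_on A U Y"
  unfolding smooth_vfield_on_def
  using smooth_vfield_on_open[OF X] smooth_vfield_on_tangent[OF X] eq
  by (auto intro!: smooth_fun_on_cong[OF A smooth_vfield_onD[OF X]])

lemma smooth_vfield_on_local:
  assumes A: "smooth_atlas A" and U: "open U"
    and loc: "\<And>p. p \<in> U \<Longrightarrow> \<exists>V. p \<in> V \<and> smooth_vfield_on A V X"
  shows "smooth_vfield_on A U X"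
  unfolding smooth_vfield_on_def
proof (intro conjI ballI U)
  fix p assume "p \<in> U"
  then show "X p \<in> tangent_space A p" using loc smooth_vfield_on_tangent by blast
next
  fix c assume c: "c \<in> A"
  show "smooth_fun_on A (U \<inter> fst c) (\<lambda>p. comp (X p) c)"
  proof (rule smooth_fun_on_local[OF A])
    show "open (U \<inter> fst c)" using U atlas_open[OF A c] by blast
    fix p assume p: "p \<in> U \<inter> fst c"
    then obtain V where "p \<in> V" "smooth_vfield_on A V X" using loc by blast
    then show "\<exists>V. p \<in> V \<and> smooth_fun_on A V (\<lambda>p. comp (X p) c)"
      using p smooth_vfield_onD[OF _ c] by blast
  qed
qed

lemma smooth_vfield_on_scaleR:
  assumes A: "smooth_atlas A" and s: "smooth_fun_on A U s" and X: "smooth_vfield_on A U X"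
  shows "smooth_vfield_on A U (\<lambda>q. s q *\<^sub>R X q)"
  unfolding smooth_vfield_on_def
proof (intro conjI ballI)
  show U: "open U" by (rule smooth_fun_on_open[OF s])
  show "s p *\<^sub>R X p \<in> tangent_space A p" if "p \<in> U" for p
    by (intro subspace_scale tangent_subspace[OF A] smooth_vfield_on_tangent[OF X that])
  show "smooth_fun_on A (U \<inter> fst c) (\<lambda>p. comp (s p *\<^sub>R X p) c)" if c: "c \<in> A" for c
    using U atlas_open[OF A c]
    by (auto intro!: smooth_fun_on_scaleR[OF A] smooth_vfield_onD[OF X c] smooth_fun_on_subset[OF s])
qed

lemma smooth_vfield_on_sum:
  assumes A: "smooth_atlas A" and U: "open U" and X: "\<And>i. i \<in> I \<Longrightarrow> smooth_vfield_on A U (X i)"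
  shows "smooth_vfield_on A U (\<lambda>q. \<Sum>i\<in>I. X i q)"
  unfolding smooth_vfield_on_def
proof (intro conjI ballI U)
  show "(\<Sum>i\<in>I. X i p) \<in> tangent_space A p" if "p \<in> U" for p
    by (intro subspace_sum tangent_subspace[OF A] smooth_vfield_on_tangent[OF X that])
  show "smooth_fun_on A (U \<inter> fst c) (\<lambda>p. comp (\<Sum>i\<in>I. X i p) c)" if c: "c \<in> A" for c
    using U atlas_open[OF A c]
    by (auto intro!: smooth_fun_on_sum[OF A] smooth_vfield_onD[OF X c])
qed

lemma smooth_vfield_on_zero: "smooth_atlas A \<Longrightarrow> open U \<Longrightarrow> smooth_vfield_on A U (\<lambda>q. 0)"
  using smooth_vfield_on_sum[of A U "{}"] by simp

lemma coord_vec_smooth: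
  assumes A: "smooth_atlas A" and c: "c \<in> A"
  shows "smooth_vfield_on A (fst c) (coord_vec A c x)"
  unfolding smooth_vfield_on_def
proof (intro conjI ballI)
  show U: "open (fst c)" by (rule atlas_open[OF A c])
  show "coord_vec A c x p \<in> tangent_space A p" if "p \<in> fst c" for p
    using that c by (intro coord_vec_tangent[OF A]) (simp add: charts_at_iff)
  fix d assume d: "d \<in> A"
  show "smooth_fun_on A (fst c \<inter> fst d) (\<lambda>p. comp (coord_vec A c x p) d)"
  proof (rule smooth_fun_onI)
    show o: "open (fst c \<inter> fst d)" using U atlas_open[OF A d] by blast
    fix e k assume e: "e \<in> A"
    let ?S = "snd e ` (fst c \<inter> fst d \<inter> fst e)"
    have S: "open ?S" by (rule open_chart_image[OF A e o])
    \<comment> \<open>The components of a coordinate field in the chart d are first derivatives of a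
      transition map, so order k of the field costs one more order of that map. A third chart e
      enters because smoothness on the manifold is tested in all charts.\<close>
    have "k_smooth_on (Suc k) (snd c ` (fst c \<inter> fst d)) (snd d \<circ> chart_inv c)"
      by (rule transition_smooth[OF A c d])
    then have g: "k_smooth_on k (snd c ` (fst c \<inter> fst d))
        (\<lambda>z. frechet_derivative (snd d \<circ> chart_inv c) (at z) x)"
      by simp
    have f: "k_smooth_on k ?S (snd c \<circ> chart_inv e)"
      by (rule k_smooth_on_subset[OF transition_smooth[OF A e c]]) auto
    have "k_smooth_on k ?S
        (\<lambda>y. frechet_derivative (snd d \<circ> chart_inv c) (at ((snd c \<circ> chart_inv e) y)) x)"
      by (rule k_smooth_on_compose[OF S g f]) (use chart_inv_left[OF A e] in auto)
    then show "k_smooth_on k ?S (\<lambda>y. comp (coord_vec A c x (chart_inv e y)) d)"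
      using chart_inv_left[OF A e] d
      by (subst k_smooth_on_cong[OF S]) (auto simp: comp_coord_vec charts_at_iff)
  qed
qed

section \<open>Smooth maps and their differentials\<close>

lemma smooth_map_comp_tdifferentiable:
  assumes "smooth_map B A f" "c \<in> charts_at A (f p)"
  shows "tdifferentiable B p (snd c \<circ> f)"
  using assms by (intro smooth_fun_on_tdifferentiable[of B "f -` fst c"]) (auto simp: smooth_map_def charts_at_iff)

lemma tderiv_compose:
  assumes A: "smooth_atlas A" and B: "smooth_atlas B" and f: "smooth_map B A f"
    and c: "c \<in> charts_at A (f p)" and h: "tdifferentiable A (f p) h"
  shows tdifferentiable_compose: "tdifferentiable B p (h \<circ> f)"
    and "v \<in> tangent_space B p \<Longrightarrow> tderiv B p v (h \<circ> f) =
      frechet_derivative (h \<circ> chart_inv c) (at (snd c (f p))) (tderiv B p v (snd c \<circ> f))"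
proof -
  obtain e where e: "e \<in> charts_at B p" using charts_at_ex[OF B] .
  have c': "c \<in> A" "f p \<in> fst c" and e': "e \<in> B" "p \<in> fst e" using c e by (auto simp: charts_at_iff)
  have p: "chart_inv e (snd e p) = p" using chart_inv_left[OF B e'] .
  note fd = smooth_map_comp_tdifferentiable[OF f c]
  have hd: "(h \<circ> chart_inv c has_derivative frechet_derivative (h \<circ> chart_inv c) (at (snd c (f p))))
      (at ((snd c \<circ> f \<circ> chart_inv e) (snd e p)))"
    using tdifferentiable_has_derivative[OF h c] by (simp add: p)
  have "((\<lambda>x. (h \<circ> chart_inv c) ((snd c \<circ> f \<circ> chart_inv e) x)) has_derivative
      (\<lambda>u. frechet_derivative (h \<circ> chart_inv c) (at (snd c (f p)))
        (frechet_derivative (snd c \<circ> f \<circ> chart_inv e) (at (snd e p)) u))) (at (snd e p))"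
    by (rule has_derivative_compose[OF tdifferentiable_has_derivative[OF fd e] hd])
  moreover have o: "open (f -` fst c)"
    using f c' smooth_fun_on_open by (auto simp: smooth_map_def)
  moreover have "open (snd e ` (f -` fst c \<inter> fst e))"
    by (rule open_chart_image[OF B e'(1) o])
  ultimately have d: "(h \<circ> f \<circ> chart_inv e has_derivative
      (\<lambda>u. frechet_derivative (h \<circ> chart_inv c) (at (snd c (f p)))
        (frechet_derivative (snd c \<circ> f \<circ> chart_inv e) (at (snd e p)) u))) (at (snd e p))"
    by (elim has_derivative_transform_within_open[where s = "snd e ` (f -` fst c \<inter> fst e)"])
      (use c' e' chart_inv_left[OF A c'(1)] chart_inv_left[OF B e'(1)] in auto)
  show "tdifferentiable B p (h \<circ> f)" by (rule tderivI(1)[OF B e d])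
  assume "v \<in> tangent_space B p"
  then show "tderiv B p v (h \<circ> f) =
      frechet_derivative (h \<circ> chart_inv c) (at (snd c (f p))) (tderiv B p v (snd c \<circ> f))"
    using tderivI(2)[OF B e d] tderiv_chart[OF B e fd] by simp
qed

lemma comp_differential:
  "c \<in> charts_at A (f p) \<Longrightarrow> comp (differential B A f p v) c = tderiv B p v (snd c \<circ> f)"
  by (simp add: differential_def)

lemma chart_tdifferentiable:
  assumes "smooth_atlas A" "c \<in> charts_at A p"
  shows "tdifferentiable A p (snd c)"
  using tderivI(1)[OF assms transition_has_derivative[OF assms assms(2)]] .

lemma differential_tangent:
  assumes A: "smooth_atlas A" and B: "smooth_atlas B" and f: "smooth_map B A f"
    and v: "v \<in> tangent_space B p"
  shows "differential B A f p v \<in> tangent_space A (f p)"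
proof -
  have "comp (differential B A f p v) c = 0" if "c \<notin> charts_at A (f p)" for c
    using that by (simp add: differential_def)
  moreover have "comp (differential B A f p v) d =
      frechet_derivative (snd d \<circ> chart_inv c) (at (snd c (f p))) (comp (differential B A f p v) c)"
    if "c \<in> charts_at A (f p)" "d \<in> charts_at A (f p)" for c d
    using tderiv_compose(2)[OF A B f that(1) chart_tdifferentiable[OF A that(2)] v] that
    by (simp add: comp_differential)
  ultimately show ?thesis by (rule tangent_spaceI)
qed

lemma tderiv_differential:
  assumes A: "smooth_atlas A" and B: "smooth_atlas B" and f: "smooth_map B A f"
    and v: "v \<in> tangent_space B p" and h: "tdifferentiable A (f p) h"
  shows "tderiv A (f p) (differential B A f p v) h = tderiv B p v (h \<circ> f)"
proof -
  obtain c where c: "c \<in> charts_at A (f p)" using charts_at_ex[OF A] .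
  show ?thesis
    using tderiv_chart[OF A c h differential_tangent[OF A B f v]] tderiv_compose(2)[OF A B f c h v]
    by (simp add: comp_differential c)
qed

text \<open>Linear on all families of components, since \<open>tderiv\<close> evaluates a fixed
  linear map at one component. The differential of the immersion can then be added and scaled
  without tangency side conditions.\<close>

lemma differential_linear:
  assumes B: "smooth_atlas B" and f: "smooth_map B A f"
  shows "linear_from UNIV (differential B A f p)"
  using tderiv_linear_from[OF B smooth_map_comp_tdifferentiable[OF f]]
  unfolding linear_from_def tvec_eq_iff
  by (auto simp: differential_def)

section \<open>Connections, bump functions and sections\<close>

lemma linear_from_zero: "linear_from S f \<Longrightarrow> subspace S \<Longrightarrow> f 0 = 0"
  unfolding linear_from_def using subspace_0 by (metis scaleR_zero_left)

lemma linear_from_sum: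
  assumes f: "linear_from S f" and S: "subspace S" and x: "\<And>i. i \<in> I \<Longrightarrow> x i \<in> S"
  shows "f (\<Sum>i\<in>I. x i) = (\<Sum>i\<in>I. f (x i))"
  using x
proof (induction I rule: infinite_finite_induct)
  case (insert i I)
  have "f (x i + sum x I) = f (x i) + f (sum x I)"
    using f insert.prems subspace_sum[OF S, of I x] by (auto simp: linear_from_def)
  then show ?case using insert by simp
qed (simp_all add: linear_from_zero[OF f S])

lemma linear_from_scaled_sum:
  assumes f: "linear_from S f" and S: "subspace S" and x: "\<And>i. i \<in> I \<Longrightarrow> x i \<in> S"
  shows "f (\<Sum>i\<in>I. r i *\<^sub>R x i) = (\<Sum>i\<in>I. r i *\<^sub>R f (x i))"
proof -
  have "f (\<Sum>i\<in>I. r i *\<^sub>R x i) = (\<Sum>i\<in>I. f (r i *\<^sub>R x i))"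
    using x by (intro linear_from_sum[OF f S]) (auto intro: subspace_scale[OF S])
  also have "\<dots> = (\<Sum>i\<in>I. r i *\<^sub>R f (x i))"
    using f x by (intro sum.cong) (auto simp: linear_from_def)
  finally show ?thesis .
qed

section \<open>Affine connections: locality and expansion in a coordinate frame\<close>

lemma connection_tangent:
  assumes "affine_connection A nab" "smooth_vfield_on A U Y" "p \<in> U" "v \<in> tangent_space A p"
  shows "nab p v Y \<in> tangent_space A p"
  by (rule assms(1)[unfolded affine_connection_def, THEN conjunct1, THEN spec, THEN spec, THEN mp,
      OF assms(2), THEN bspec, OF assms(3), THEN conjunct2, THEN bspec, OF assms(4)])

lemma connection_add:
  assumes "affine_connection A nab" "smooth_vfield_on A U Y" "smooth_vfield_on A U Z" "p \<in> U"
    and "v \<in> tangent_space A p"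
  shows "nab p v (\<lambda>q. Y q + Z q) = nab p v Y + nab p v Z"
  by (rule assms(1)[unfolded affine_connection_def, THEN conjunct2, THEN conjunct1, THEN spec, THEN spec,
      THEN spec, THEN mp, OF conjI[OF assms(2,3)], THEN bspec, OF assms(4), THEN bspec, OF assms(5)])

lemma connection_scaleR:
  assumes "affine_connection A nab" "smooth_fun_on A U h" "smooth_vfield_on A U Y" "p \<in> U"
    and "v \<in> tangent_space A p"
  shows "nab p v (\<lambda>q. h q *\<^sub>R Y q) = tderiv A p v h *\<^sub>R Y p + h p *\<^sub>R nab p v Y"
  by (rule assms(1)[unfolded affine_connection_def, THEN conjunct2, THEN conjunct2, THEN conjunct1, THEN spec,
      THEN spec, THEN spec, THEN mp, OF conjI[OF assms(2,3)], THEN bspec, OF assms(4), THEN bspec, OF assms(5)])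

lemma connection_cong:
  assumes A: "smooth_atlas A" and nab: "affine_connection A nab"
    and Y: "smooth_vfield_on A U Y" and Z: "smooth_vfield_on A U Z"
    and eq: "\<And>q. q \<in> U \<Longrightarrow> Y q = Z q" and p: "p \<in> U" and v: "v \<in> tangent_space A p"
  shows "nab p v Y = nab p v Z"
proof -
  \<comment> \<open>The indicator function of U is smooth on U, being constant there. Its products
    with Y and Z are equal everywhere, and the derivative terms of the two Leibniz rules coincide
    because Y and Z agree at p.\<close>
  let ?h = "\<lambda>q. if q \<in> U then 1 else 0 :: real"
  have h: "smooth_fun_on A U ?h"
    by (rule smooth_fun_on_cong[OF A smooth_fun_on_const[OF smooth_vfield_on_open[OF Y], of _ 1]]) simp
  have "(\<lambda>q. ?h q *\<^sub>R Y q) = (\<lambda>q. ?h q *\<^sub>R Z q)" using eq by auto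
  then have "tderiv A p v ?h *\<^sub>R Y p + ?h p *\<^sub>R nab p v Y = tderiv A p v ?h *\<^sub>R Z p + ?h p *\<^sub>R nab p v Z"
    using connection_scaleR[OF nab h Y p v] connection_scaleR[OF nab h Z p v] by metis
  then show ?thesis using p eq by simp
qed

lemma connection_sum:
  assumes A: "smooth_atlas A" and nab: "affine_connection A nab" and U: "open U" "p \<in> U"
    and X: "\<And>i. i \<in> I \<Longrightarrow> smooth_vfield_on A U (X i)" and v: "v \<in> tangent_space A p"
  shows "nab p v (\<lambda>q. \<Sum>i\<in>I. X i q) = (\<Sum>i\<in>I. nab p v (X i))"
proof -
  have zero: "nab p v (\<lambda>q. 0) = 0"
    using connection_add[OF nab smooth_vfield_on_zero[OF A U(1)] smooth_vfield_on_zero[OF A U(1)] U(2) v]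
    by simp
  show ?thesis
    using X
  proof (induction I rule: infinite_finite_induct)
    case (insert i I)
    have "nab p v (\<lambda>q. X i q + (\<Sum>i\<in>I. X i q)) = nab p v (X i) + nab p v (\<lambda>q. \<Sum>i\<in>I. X i q)"
      using insert.prems
      by (intro connection_add[OF nab _ _ U(2) v] smooth_vfield_on_sum[OF A U(1)]) auto
    then show ?case using insert by simp
  qed (simp_all add: zero)
qed

text \<open>Brings a genuine covariant derivative into the shape of the formula in
  \<open>cov_along\<close>; it serves to expand the derivative of an endomorphism applied to a
  coordinate field. The frame represents Y only on the chart domain, so
  \<open>connection_cong\<close> is needed.\<close>

lemma connection_coord_frame:
  assumes A: "smooth_atlas A" and nab: "affine_connection A nab"
    and c: "c \<in> charts_at A p" and Y: "smooth_vfield_on A (fst c) Y" and v: "v \<in> tangent_space A p"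
  shows "nab p v Y = (\<Sum>b\<in>Basis. tderiv A p v (\<lambda>q. comp (Y q) c \<bullet> b) *\<^sub>R coord_vec A c b p +
    (comp (Y p) c \<bullet> b) *\<^sub>R nab p v (coord_vec A c b))"
proof -
  have c': "c \<in> A" "p \<in> fst c" using c by (auto simp: charts_at_iff)
  note E = coord_vec_smooth[OF A c'(1)]
  have s: "smooth_fun_on A (fst c) (\<lambda>q. comp (Y q) c \<bullet> b)" for b
    using smooth_vfield_onD[OF Y c'(1)]
    by (intro smooth_fun_on_bounded_linear[OF A bounded_linear_inner_left]) simp
  have sE: "smooth_vfield_on A (fst c) (\<lambda>q. (comp (Y q) c \<bullet> b) *\<^sub>R coord_vec A c b q)" for b
    by (rule smooth_vfield_on_scaleR[OF A s E])
  have "nab p v Y = nab p v (\<lambda>q. \<Sum>b\<in>Basis. (comp (Y q) c \<bullet> b) *\<^sub>R coord_vec A c b q)"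
    by (rule connection_cong[OF A nab Y smooth_vfield_on_sum[OF A atlas_open[OF A c'(1)] sE] _ c'(2) v])
      (intro tangent_expand[OF A] smooth_vfield_on_tangent[OF Y]; simp add: charts_at_iff c')
  also have "\<dots> = (\<Sum>b\<in>Basis. nab p v (\<lambda>q. (comp (Y q) c \<bullet> b) *\<^sub>R coord_vec A c b q))"
    by (rule connection_sum[OF A nab atlas_open[OF A c'(1)] c'(2) sE v])
  also have "\<dots> = (\<Sum>b\<in>Basis. tderiv A p v (\<lambda>q. comp (Y q) c \<bullet> b) *\<^sub>R coord_vec A c b p +
    (comp (Y p) c \<bullet> b) *\<^sub>R nab p v (coord_vec A c b))"
    by (simp add: connection_scaleR[OF nab s E c'(2) v])
  finally show ?thesis .
qed

section \<open>Endomorphism fields and covariant derivatives along a map\<close>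

lemma smooth_endomorphism_linear:
  "smooth_endomorphism A P \<Longrightarrow> linear_from (tangent_space A p) (P p)"
  by (simp add: smooth_endomorphism_def)

lemma smooth_endomorphism_tangent:
  "smooth_endomorphism A P \<Longrightarrow> u \<in> tangent_space A p \<Longrightarrow> P p u \<in> tangent_space A p"
  unfolding smooth_endomorphism_def by blast

lemma smooth_endomorphism_coord_vec:
  "smooth_endomorphism A P \<Longrightarrow> c \<in> A \<Longrightarrow> smooth_vfield_on A (fst c) (\<lambda>p. P p (coord_vec A c x p))"
  unfolding smooth_endomorphism_def by blast

lemma comp_smooth_endomorphism:
  assumes A: "smooth_atlas A" and P: "smooth_endomorphism A P"
    and c: "c \<in> charts_at A p" and u: "u \<in> tangent_space A p"
  shows "comp (P p u) c = (\<Sum>a\<in>Basis. (comp u c \<bullet> a) *\<^sub>R comp (P p (coord_vec A c a p)) c)"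
proof -
  have "P p u = P p (\<Sum>a\<in>Basis. (comp u c \<bullet> a) *\<^sub>R coord_vec A c a p)"
    using tangent_expand[OF A c u] by simp
  also have "\<dots> = (\<Sum>a\<in>Basis. (comp u c \<bullet> a) *\<^sub>R P p (coord_vec A c a p))"
    by (intro linear_from_scaled_sum[OF smooth_endomorphism_linear[OF P] tangent_subspace[OF A]]
        coord_vec_tangent[OF A c])
  finally show ?thesis by simp
qed

text \<open>By fibrewise linearity, the components of PV near p are the sum over a of V_a times the
  components of P E_a pulled back by f, where E_a are the coordinate fields. The product rule
  applies to this sum even if V does not extend to a field of the target.\<close>

lemma tderiv_endomorphism_along:
  assumes A: "smooth_atlas A" and B: "smooth_atlas B" and f: "smooth_map B A f"
    and P: "smooth_endomorphism A P"
    and V: "\<And>q. V q \<in> tangent_space A (f q)"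
    and dV: "\<And>c. c \<in> charts_at A (f p) \<Longrightarrow> tdifferentiable B p (\<lambda>q. comp (V q) c)"
    and c: "c \<in> charts_at A (f p)"
  shows tdifferentiable_endomorphism_along: "tdifferentiable B p (\<lambda>q. comp (P (f q) (V q)) c)"
    and "v \<in> tangent_space B p \<Longrightarrow> tderiv B p v (\<lambda>q. comp (P (f q) (V q)) c) =
      (\<Sum>a\<in>Basis.
        (comp (V p) c \<bullet> a) *\<^sub>R tderiv B p v ((\<lambda>q. comp (P q (coord_vec A c a q)) c) \<circ> f) +
        tderiv B p v (\<lambda>q. comp (V q) c \<bullet> a) *\<^sub>R comp (P (f p) (coord_vec A c a (f p))) c)"
proof -
  have c': "c \<in> A" "f p \<in> fst c" using c by (auto simp: charts_at_iff)
  let ?P = "\<lambda>a q. comp (P q (coord_vec A c a q)) c"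
  let ?G = "\<lambda>q. \<Sum>a\<in>Basis. (comp (V q) c \<bullet> a) *\<^sub>R (?P a \<circ> f) q"
  have o: "open (f -` fst c)"
    using f c' smooth_fun_on_open by (auto simp: smooth_map_def)
  have eq: "comp (P (f q) (V q)) c = ?G q" if "q \<in> f -` fst c" for q
    using comp_smooth_endomorphism[OF A P _ V, of c q] that c' by (simp add: charts_at_iff)
  have "tdifferentiable A (f p) (?P a)" for a
    using smooth_vfield_onD[OF smooth_endomorphism_coord_vec[OF P c'(1)] c'(1)] c'(2)
    by (intro smooth_fun_on_tdifferentiable[of A "fst c"]) auto
  then have dP: "tdifferentiable B p (?P a \<circ> f)" for a
    by (rule tdifferentiable_compose[OF A B f c])
  have da: "tdifferentiable B p (\<lambda>q. comp (V q) c \<bullet> a)" for a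
    by (rule tdifferentiable_bounded_linear[OF B bounded_linear_inner_left dV[OF c]])
  have ds: "tdifferentiable B p (\<lambda>q. (comp (V q) c \<bullet> a) *\<^sub>R (?P a \<circ> f) q)" for a
    by (rule tdifferentiable_scaleR[OF B da dP])
  have dG: "tdifferentiable B p ?G" by (rule tdifferentiable_sum[OF B ds])
  show "tdifferentiable B p (\<lambda>q. comp (P (f q) (V q)) c)"
    using dG tdifferentiable_cong[OF B o _ eq] c' by auto
  assume v: "v \<in> tangent_space B p"
  have "tderiv B p v (\<lambda>q. comp (P (f q) (V q)) c) = tderiv B p v ?G"
    using tderiv_cong'[OF B o _ eq] c' by auto
  also have "\<dots> = (\<Sum>a\<in>Basis. tderiv B p v (\<lambda>q. (comp (V q) c \<bullet> a) *\<^sub>R (?P a \<circ> f) q))"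
    by (rule tderiv_sum(2)[OF B ds v])
  also have "\<dots> = (\<Sum>a\<in>Basis. (comp (V p) c \<bullet> a) *\<^sub>R tderiv B p v (?P a \<circ> f) +
      tderiv B p v (\<lambda>q. comp (V q) c \<bullet> a) *\<^sub>R ?P a (f p))"
    using tderiv_scaleR(2)[OF B da dP v] by (intro sum.cong) auto
  finally show "tderiv B p v (\<lambda>q. comp (P (f q) (V q)) c) =
      (\<Sum>a\<in>Basis. (comp (V p) c \<bullet> a) *\<^sub>R tderiv B p v (?P a \<circ> f) +
        tderiv B p v (\<lambda>q. comp (V q) c \<bullet> a) *\<^sub>R ?P a (f p))" .
qed

lemma cov_along_tangent:
  assumes A: "smooth_atlas A" and B: "smooth_atlas B" and f: "smooth_map B A f"
    and nab: "affine_connection A nab" and v: "v \<in> tangent_space B p"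
  shows "cov_along B A nab f p v V \<in> tangent_space A (f p)"
proof -
  have c: "(SOME c. c \<in> charts_at A (f p)) \<in> charts_at A (f p)" by (rule some_chart[OF A])
  then have c': "(SOME c. c \<in> charts_at A (f p)) \<in> A" "f p \<in> fst (SOME c. c \<in> charts_at A (f p))"
    unfolding charts_at_iff by blast+
  show ?thesis
    unfolding cov_along_def Let_def
    by (intro subspace_sum subspace_add subspace_scale tangent_subspace[OF A] coord_vec_tangent[OF A c]
        connection_tangent[OF nab coord_vec_smooth[OF A c'(1)] c'(2)] differential_tangent[OF A B f v])
qed

lemma cov_along_uminus:
  assumes A: "smooth_atlas A" and B: "smooth_atlas B" and v: "v \<in> tangent_space B p"
    and dV: "\<And>c. c \<in> charts_at A (f p) \<Longrightarrow> tdifferentiable B p (\<lambda>q. comp (V q) c)"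
  shows "cov_along B A nab f p v (\<lambda>q. - V q) = - cov_along B A nab f p v V"
proof -
  define c where "c = (SOME c. c \<in> charts_at A (f p))"
  have c: "c \<in> charts_at A (f p)" unfolding c_def by (rule some_chart[OF A])
  have "tdifferentiable B p (\<lambda>q. comp (V q) c \<bullet> b)" for b
    by (rule tdifferentiable_bounded_linear[OF B bounded_linear_inner_left dV[OF c]])
  from tderiv_bounded_linear(2)[OF B bounded_linear_minus[OF bounded_linear_ident] this v]
  show ?thesis
    by (simp add: cov_along_def Let_def flip: c_def sum_negf)
qed

text \<open>Transfers parallelism from fields of the target to fields along f. Both sides are
  written in one chart as combinations of the coordinate vectors E_b and their covariant
  derivatives, and the coefficients are compared.\<close>

lemma cov_along_parallel_endomorphism:
  assumes A: "smooth_atlas A" and B: "smooth_atlas B" and f: "smooth_map B A f"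
    and nab: "affine_connection A nab" and P: "smooth_endomorphism A P"
    and parallel: "\<And>U Y p v. smooth_vfield_on A U Y \<Longrightarrow> p \<in> U \<Longrightarrow> v \<in> tangent_space A p \<Longrightarrow>
      nab p v (\<lambda>q. P q (Y q)) = P p (nab p v Y)"
    and V: "\<And>q. V q \<in> tangent_space A (f q)"
    and dV: "\<And>c. c \<in> charts_at A (f p) \<Longrightarrow> tdifferentiable B p (\<lambda>q. comp (V q) c)"
    and v: "v \<in> tangent_space B p"
  shows "cov_along B A nab f p v (\<lambda>q. P (f q) (V q)) = P (f p) (cov_along B A nab f p v V)"
proof -
  define c where "c = (SOME c. c \<in> charts_at A (f p))"
  have c: "c \<in> charts_at A (f p)" unfolding c_def by (rule some_chart[OF A])
  then have c': "c \<in> A" "f p \<in> fst c" by (auto simp: charts_at_iff)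
  define w where "w = differential B A f p v"
  have w: "w \<in> tangent_space A (f p)" unfolding w_def by (rule differential_tangent[OF A B f v])
  define E where "E = (\<lambda>b. coord_vec A c b (f p))"
  define NE where "NE = (\<lambda>b. nab (f p) w (coord_vec A c b))"
  \<comment> \<open>\<open>Q a\<close> holds the components of P E_a, so it is a column of the
    matrix of P; \<open>s a\<close> is its derivative along f. \<open>x\<close> and \<open>t\<close>
    are the values and the derivatives of the components of V.\<close>
  define Q where "Q = (\<lambda>a q. comp (P q (coord_vec A c a q)) c)"
  define x where "x = (\<lambda>a. comp (V p) c \<bullet> a)"
  define t where "t = (\<lambda>a. tderiv B p v (\<lambda>q. comp (V q) c \<bullet> a))"
  define s where "s = (\<lambda>a. tderiv B p v (Q a \<circ> f))"
  have E: "E b \<in> tangent_space A (f p)" for b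
    unfolding E_def by (rule coord_vec_tangent[OF A c])
  have NE: "NE b \<in> tangent_space A (f p)" for b
    unfolding NE_def by (rule connection_tangent[OF nab coord_vec_smooth[OF A c'(1)] c'(2) w])
  note PE = smooth_endomorphism_coord_vec[OF P c'(1)]
  have dQ: "tdifferentiable A (f p) (Q a)" for a
    using smooth_vfield_onD[OF PE c'(1)] c'(2) unfolding Q_def
    by (intro smooth_fun_on_tdifferentiable[of A "fst c"]) auto
  have P_E: "P (f p) (E a) = (\<Sum>b\<in>Basis. (Q a (f p) \<bullet> b) *\<^sub>R E b)" for a
    unfolding E_def Q_def
    by (rule tangent_expand[OF A c smooth_endomorphism_tangent[OF P coord_vec_tangent[OF A c]]])
  \<comment> \<open>The only place where parallelism of P is used, at a coordinate field of the
    target. The derivative of \<open>Q a\<close> in the direction \<open>w\<close> is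
    \<open>s a\<close> because \<open>w\<close> is the image of v under the differential of
    f.\<close>
  have P_NE: "P (f p) (NE a) = (\<Sum>b\<in>Basis. (s a \<bullet> b) *\<^sub>R E b + (Q a (f p) \<bullet> b) *\<^sub>R NE b)" for a
  proof -
    have "P (f p) (NE a) = nab (f p) w (\<lambda>q. P q (coord_vec A c a q))"
      unfolding NE_def using parallel[OF coord_vec_smooth[OF A c'(1)] c'(2) w] by simp
    moreover have "tderiv A (f p) w (\<lambda>q. Q a q \<bullet> b) = s a \<bullet> b" for b
      using tderiv_bounded_linear(2)[OF A bounded_linear_inner_left dQ w]
        tderiv_differential[OF A B f v dQ]
      by (simp add: s_def w_def)
    ultimately show ?thesis
      using connection_coord_frame[OF A nab c PE w] by (simp add: E_def NE_def Q_def)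
  qed
  have cov: "cov_along B A nab f p v V = (\<Sum>a\<in>Basis. t a *\<^sub>R E a + x a *\<^sub>R NE a)"
    by (simp add: cov_along_def Let_def t_def E_def x_def NE_def w_def flip: c_def)
  have lin: "linear_from (tangent_space A (f p)) (P (f p))"
    by (rule smooth_endomorphism_linear[OF P])
  have "P (f p) (t a *\<^sub>R E a + x a *\<^sub>R NE a) = t a *\<^sub>R P (f p) (E a) + x a *\<^sub>R P (f p) (NE a)" for a
    using lin E NE subspace_scale[OF tangent_subspace[OF A]] by (auto simp: linear_from_def)
  then have "P (f p) (cov_along B A nab f p v V) =
      (\<Sum>a\<in>Basis. t a *\<^sub>R P (f p) (E a) + x a *\<^sub>R P (f p) (NE a))"
    unfolding cov
    by (subst linear_from_sum[OF lin tangent_subspace[OF A]])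
      (auto intro!: subspace_add subspace_scale tangent_subspace[OF A] E NE)
  also have "\<dots> = (\<Sum>a\<in>Basis. \<Sum>b\<in>Basis.
      (x a * (s a \<bullet> b) + t a * (Q a (f p) \<bullet> b)) *\<^sub>R E b + (x a * (Q a (f p) \<bullet> b)) *\<^sub>R NE b)"
    unfolding P_E P_NE
    by (simp add: scaleR_sum_right sum.distrib[symmetric] algebra_simps)
  \<comment> \<open>After the exchange, the coefficient of \<open>NE b\<close> is the b-th component
    of PV at p and that of \<open>E b\<close> is its derivative in the direction v, as
    \<open>cov_along\<close> demands for PV.\<close>
  also have "\<dots> = (\<Sum>b\<in>Basis. \<Sum>a\<in>Basis.
      (x a * (s a \<bullet> b) + t a * (Q a (f p) \<bullet> b)) *\<^sub>R E b + (x a * (Q a (f p) \<bullet> b)) *\<^sub>R NE b)"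
    by (rule sum.swap)
  also have "\<dots> = (\<Sum>b\<in>Basis. (\<Sum>a\<in>Basis. x a * (s a \<bullet> b) + t a * (Q a (f p) \<bullet> b)) *\<^sub>R E b +
      (\<Sum>a\<in>Basis. x a * (Q a (f p) \<bullet> b)) *\<^sub>R NE b)"
    by (subst sum.distrib) (simp only: scaleR_sum_left)
  also have "\<dots> = cov_along B A nab f p v (\<lambda>q. P (f q) (V q))"
  proof -
    have dPV: "tdifferentiable B p (\<lambda>q. comp (P (f q) (V q)) c)"
      by (rule tdifferentiable_endomorphism_along[OF A B f P V dV c])
    have "tderiv B p v (\<lambda>q. comp (P (f q) (V q)) c \<bullet> b) =
        (\<Sum>a\<in>Basis. x a * (s a \<bullet> b) + t a * (Q a (f p) \<bullet> b))" for b
      using tderiv_bounded_linear(2)[OF B bounded_linear_inner_left dPV v, of b]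
        tderiv_endomorphism_along(2)[OF A B f P V dV c v]
      by (simp add: x_def s_def t_def Q_def inner_sum_left inner_add_left)
    moreover have "comp (P (f p) (V p)) c \<bullet> b = (\<Sum>a\<in>Basis. x a * (Q a (f p) \<bullet> b))" for b
      using comp_smooth_endomorphism[OF A P c V]
      by (simp add: x_def Q_def inner_sum_left)
    ultimately show ?thesis
      by (simp add: cov_along_def Let_def E_def NE_def w_def flip: c_def)
  qed
  finally show ?thesis by simp
qed

lemma differential_vfield_tdifferentiable:
  assumes A: "smooth_atlas A" and B: "smooth_atlas B" and f: "smooth_map B A f"
    and Y: "smooth_vfield_on B U Y" and p: "p \<in> U" and c: "c \<in> charts_at A (f p)"
  shows "tdifferentiable B p (\<lambda>q. comp (differential B A f q (Y q)) c)"
proof -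
  obtain d where d: "d \<in> charts_at B p" using charts_at_ex[OF B] .
  have c': "c \<in> A" "f p \<in> fst c" and d': "d \<in> B" "p \<in> fst d" using c d by (auto simp: charts_at_iff)
  have sm: "smooth_fun_on B (f -` fst c) (snd c \<circ> f)" using f c' by (simp add: smooth_map_def)
  let ?W = "U \<inter> f -` fst c"
  have W: "open ?W" using smooth_fun_on_open[OF sm] smooth_vfield_on_open[OF Y] by blast
  let ?S = "snd d ` (?W \<inter> fst d)"
  have S: "open ?S" by (rule open_chart_image[OF B d'(1) W])
  let ?g = "\<lambda>z. \<Sum>i\<in>Basis. (comp (Y (chart_inv d z)) d \<bullet> i) *\<^sub>R
      frechet_derivative (snd c \<circ> f \<circ> chart_inv d) (at z) i"
  \<comment> \<open>The components of the pushed-forward field contain first derivatives of f at a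
    moving point. Differentiating them once more takes order two of f, but only order one of
    Y.\<close>
  have "k_smooth_on (Suc 0) ?S (\<lambda>z. frechet_derivative (snd c \<circ> f \<circ> chart_inv d) (at z) i)" for i
    by (rule k_smooth_on_subset[OF spec[OF conjunct2[OF
          smooth_fun_onD[OF sm d'(1), of "Suc (Suc 0)", unfolded k_smooth_on.simps(2)[of "Suc 0"]]]]]) auto
  moreover have "k_smooth_on (Suc 0) ?S (\<lambda>z. comp (Y (chart_inv d z)) d)"
    by (rule k_smooth_on_subset[OF smooth_fun_onD[OF smooth_vfield_onD[OF Y d'(1)] d'(1), unfolded o_def]]) auto
  ultimately have "k_smooth_on (Suc 0) ?S ?g"
    by (intro k_smooth_on_sum[OF S] k_smooth_on_bilinear[OF S bounded_bilinear_scaleR]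
        k_smooth_on_bounded_linear[OF S bounded_linear_inner_left])
  moreover have "comp (differential B A f (chart_inv d z) (Y (chart_inv d z))) c = ?g z" if z: "z \<in> ?S" for z
  proof -
    obtain q where q: "q \<in> U" "f q \<in> fst c" "q \<in> fst d" "z = snd d q" using z by auto
    have dq: "d \<in> charts_at B q" "c \<in> charts_at A (f q)" using q d' c' by (auto simp: charts_at_iff)
    have inv: "chart_inv d z = q" using q chart_inv_left[OF B d'(1)] by simp
    note td = smooth_map_comp_tdifferentiable[OF f dq(2)]
    have "linear (frechet_derivative (snd c \<circ> f \<circ> chart_inv d) (at z))"
      using has_derivative_linear[OF tdifferentiable_has_derivative[OF td dq(1)]] q by simp
    then show ?thesis
      unfolding inv
      using tderiv_chart[OF B dq(1) td smooth_vfield_on_tangent[OF Y q(1)]] q(4)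
        linear_euclidean_expand[of "frechet_derivative (snd c \<circ> f \<circ> chart_inv d) (at z)" "comp (Y q) d"]
      by (simp add: comp_differential dq(2))
  qed
  ultimately have "k_smooth_on (Suc 0) ?S ((\<lambda>q. comp (differential B A f q (Y q)) c) \<circ> chart_inv d)"
    using k_smooth_on_cong[OF S, of "(\<lambda>q. comp (differential B A f q (Y q)) c) \<circ> chart_inv d" ?g] by simp
  then have "((\<lambda>q. comp (differential B A f q (Y q)) c) \<circ> chart_inv d) differentiable (at (snd d p))"
    using p c' d' by auto
  from has_derivative_frechet[OF this] show ?thesis
    by (rule tdifferentiableI[OF B d])
qed

section \<open>Bump functions and global sections on a manifold\<close>

text \<open>A Euclidean bump is transplanted by a chart and extended by zero. K is the preimage of a
  closed ball, hence compact, hence closed in a Hausdorff space; the chart domain and the complement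
  of K are then an open cover on whose members smoothness is evident. K is exported because
  extending sections by zero repeats this argument.\<close>

lemma bump_function:
  assumes A: "smooth_atlas A" and W: "open W" "p \<in> W"
  obtains \<beta> K where "smooth_fun_on A UNIV \<beta>" "\<beta> p = (1::real)" "closed K" "K \<subseteq> W"
    "\<And>q. q \<notin> K \<Longrightarrow> \<beta> q = 0"
proof -
  obtain c where c: "c \<in> charts_at A p" using charts_at_ex[OF A] .
  then have c': "c \<in> A" "p \<in> fst c" by (auto simp: charts_at_iff)
  note inv = chart_inv_left[OF A c'(1)]
  obtain r where r: "r > 0" "cball (snd c p) r \<subseteq> snd c ` (W \<inter> fst c)"
    using open_chart_image[OF A c'(1) W(1)] W(2) c'(2) open_contains_cball by blast
  obtain b :: "'b \<Rightarrow> real" where b: "\<And>k. k_smooth_on k UNIV b" "b (snd c p) = 1"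
    "\<And>x. x \<notin> cball (snd c p) r \<Longrightarrow> b x = 0"
    using euclidean_bump[OF r(1)] by blast
  define K where "K = chart_inv c ` cball (snd c p) r"
  have K_eq: "q \<in> K \<longleftrightarrow> snd c q \<in> cball (snd c p) r" if "q \<in> fst c" for q
  proof
    assume "q \<in> K"
    then obtain x where x: "x \<in> cball (snd c p) r" "q = chart_inv c x" by (auto simp: K_def)
    then obtain q' where "q' \<in> fst c" "x = snd c q'" using r(2) by auto
    then show "snd c q \<in> cball (snd c p) r" using x inv by auto
  next
    assume "snd c q \<in> cball (snd c p) r"
    then show "q \<in> K" using inv[OF that] by (force simp: K_def)
  qed
  have KW: "K \<subseteq> W \<inter> fst c"
  proof
    fix q assume "q \<in> K"
    then obtain x where x: "x \<in> cball (snd c p) r" "q = chart_inv c x" by (auto simp: K_def)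
    then obtain q' where "q' \<in> W \<inter> fst c" "x = snd c q'" using r(2) by auto
    then show "q \<in> W \<inter> fst c" using x inv by auto
  qed
  have "continuous_on (cball (snd c p) r) (chart_inv c)"
    by (rule continuous_on_subset[OF homeomorphism_cont2[OF atlas_homeomorphism[OF A c'(1)]]]) (use r(2) in auto)
  then have K: "closed K"
    unfolding K_def by (intro compact_imp_closed compact_continuous_image) auto
  define \<beta> where "\<beta> = (\<lambda>q. if q \<in> fst c then b (snd c q) else 0)"
  have zero: "\<beta> q = 0" if "q \<notin> K" for q
    using that b(3) K_eq by (auto simp: \<beta>_def)
  have "smooth_fun_on A (fst c) (\<lambda>q. b (snd c q))"
  proof (rule smooth_fun_onI)
    show "open (fst c)" by (rule atlas_open[OF A c'(1)])
    then show "k_smooth_on k (snd d ` (fst c \<inter> fst d)) (\<lambda>x. b (snd c (chart_inv d x)))" if "d \<in> A" for d k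
      using transition_smooth[OF A that c'(1)]
      by (intro k_smooth_on_compose[OF open_chart_image[OF A that] b(1)]) (auto simp: o_def Int_commute)
  qed
  then have "smooth_fun_on A (fst c) \<beta>"
    by (rule smooth_fun_on_cong[OF A]) (simp add: \<beta>_def)
  moreover have "smooth_fun_on A (- K) \<beta>"
    by (rule smooth_fun_on_cong[OF A smooth_fun_on_const[of _ _ 0]]) (use K zero in auto)
  ultimately have "smooth_fun_on A UNIV \<beta>"
    by (intro smooth_fun_on_local[OF A open_UNIV]) (use KW in blast)
  moreover have "\<beta> p = 1" using c' b(2) by (simp add: \<beta>_def)
  ultimately show ?thesis using that K KW zero by blast
qed

text \<open>A combination of the local frame with constant coefficients takes the value v at p and
  stays in \<open>D\<close> throughout U. Multiplied by a bump function vanishing off a closed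
  subset of U, it extends by zero to a global section.\<close>

lemma section_through:
  assumes A: "smooth_atlas A" and D: "distribution A r D" and v: "v \<in> D p"
  obtains Z where "Z \<in> sections A D" "Z p = v"
proof -
  have Dq: "subspace (D q)" for q using D by (simp add: distribution_def)
  obtain U E where U: "p \<in> U" and E: "\<And>i. i < r \<Longrightarrow> smooth_vfield_on A U (E i)"
    and span: "\<And>q. q \<in> U \<Longrightarrow> D q = span ((\<lambda>i. E i q) ` {..<r})"
    using D unfolding distribution_def by metis
  obtain k where k: "v = (\<Sum>i<r. k i *\<^sub>R E i p)"
  proof -
    have "v \<in> span ((\<lambda>i. E i p) ` {..<r})" using v span U by simp
    then have "\<exists>k. v = (\<Sum>i<r. k i *\<^sub>R E i p)"
    proof (induction rule: span_induct_alt)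
      case base
      show ?case by (rule exI[of _ "\<lambda>_. 0"]) simp
    next
      case (step a x y)
      then obtain j k where j: "j < r" "x = E j p" and y: "y = (\<Sum>i<r. k i *\<^sub>R E i p)" by auto
      have "a *\<^sub>R x + y = (\<Sum>i<r. ((if i = j then a else 0) + k i) *\<^sub>R E i p)"
        using j by (simp add: y scaleR_add_left sum.distrib if_distrib[of "\<lambda>z. z *\<^sub>R _"] cong: if_cong)
      then show ?case by (rule exI[of _ "\<lambda>i. (if i = j then a else 0) + k i"])
    qed
    then show ?thesis using that by blast
  qed
  define X where "X = (\<lambda>q. \<Sum>i<r. k i *\<^sub>R E i q)"
  show ?thesis
  \<comment> \<open>Openness of U is only available through smoothness of the frame fields, so it is
    lost when the frame is empty; but then v = 0 and the zero section serves.\<close>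
  proof (cases "r = 0")
    case True
    then have "v = 0" using k by simp
    then show ?thesis
      using that[of "\<lambda>q. 0"] smooth_vfield_on_zero[OF A open_UNIV] subspace_0[OF Dq]
      by (simp add: sections_def)
  next
    case False
    then have oU: "open U" using E smooth_vfield_on_open by blast
    have X: "smooth_vfield_on A U X"
      unfolding X_def
      by (intro smooth_vfield_on_sum[OF A oU] smooth_vfield_on_scaleR[OF A] smooth_fun_on_const[OF oU] E) simp
    have XD: "X q \<in> D q" if "q \<in> U" for q
      unfolding X_def span[OF that] by (intro span_sum span_scale span_base) auto
    obtain \<beta> K where \<beta>: "smooth_fun_on A UNIV \<beta>" "\<beta> p = 1" "closed K" "K \<subseteq> U"
      "\<And>q. q \<notin> K \<Longrightarrow> \<beta> q = (0::real)"
      using bump_function[OF A oU U] by metis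
    define Z where "Z = (\<lambda>q. if q \<in> U then \<beta> q *\<^sub>R X q else 0)"
    have "smooth_vfield_on A U Z"
      by (rule smooth_vfield_on_cong[OF A smooth_vfield_on_scaleR[OF A smooth_fun_on_subset[OF \<beta>(1) oU] X]])
        (auto simp: Z_def)
    moreover have "smooth_vfield_on A (- K) Z"
      by (rule smooth_vfield_on_cong[OF A smooth_vfield_on_zero[OF A]]) (use \<beta> in \<open>auto simp: Z_def\<close>)
    ultimately have "smooth_vfield_on A UNIV Z"
      by (intro smooth_vfield_on_local[OF A open_UNIV]) (use \<beta>(4) in blast)
    moreover have "Z q \<in> D q" for q
      using XD subspace_scale[OF Dq] subspace_0[OF Dq] by (simp add: Z_def)
    moreover have "Z p = v" using U \<beta>(2) k by (simp add: Z_def X_def)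
    ultimately show ?thesis by (intro that[of Z]) (simp_all add: sections_def)
  qed
qed

section \<open>Immersions into cosymplectic manifolds\<close>

locale cosymplectic_immersion =
  fixes N :: "('m::{t2_space, second_countable_topology}, 'e::euclidean_space) contact_structure"
    and nab :: "('m, 'e) connection"
    and M :: "('n::{t2_space, second_countable_topology}, 'd::euclidean_space, 'm) immersed"
  assumes cosymplectic: "cosymplectic_manifold N nab"
    and immersion: "isometric_immersion M N"
begin

abbreviation TN :: "'n \<Rightarrow> ('m, 'e) tvec set"
  where "TN p \<equiv> tangent_space (atlas N) (imm M p)"

lemma almost_contact: "almost_contact_metric_manifold N"
  using cosymplectic unfolding cosymplectic_manifold_def by (rule conjunct1)

lemma atlas_N: "smooth_atlas (atlas N)"
  using almost_contact unfolding almost_contact_metric_manifold_def by (rule conjunct1)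

lemma phi_smooth: "smooth_endomorphism (atlas N) (phi N)"
  using almost_contact unfolding almost_contact_metric_manifold_def by (elim conjE)

lemma xi_tangent: "xi N p \<in> tangent_space (atlas N) p"
proof -
  have "smooth_vfield_on (atlas N) UNIV (xi N)"
    using almost_contact unfolding almost_contact_metric_manifold_def by (elim conjE)
  then show ?thesis by (rule smooth_vfield_on_tangent) simp
qed

lemma eta_smooth: "smooth_one_form (atlas N) (eta N)"
  using almost_contact unfolding almost_contact_metric_manifold_def by (elim conjE)

lemma metric_N: "riemannian_metric (atlas N) (metric N)"
  using almost_contact unfolding almost_contact_metric_manifold_def by (elim conjE)

lemma contact_axioms:
  "\<forall>p. phi N p (xi N p) = 0 \<and> eta N p (xi N p) = 1 \<and>
      (\<forall>u\<in>tangent_space (atlas N) p.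
         phi N p (phi N p u) = - u + eta N p u *\<^sub>R xi N p \<and>
         eta N p (phi N p u) = 0 \<and>
         eta N p u = metric N p u (xi N p) \<and>
         (\<forall>v\<in>tangent_space (atlas N) p.
            metric N p (phi N p u) (phi N p v) = metric N p u v - eta N p u * eta N p v))"
  using almost_contact unfolding almost_contact_metric_manifold_def by (elim conjE)

lemma contact_identities:
  assumes "u \<in> tangent_space (atlas N) p"
  shows phi_phi: "phi N p (phi N p u) = - u + eta N p u *\<^sub>R xi N p"
    and eta_eq_metric: "eta N p u = metric N p u (xi N p)"
    and metric_phi: "v \<in> tangent_space (atlas N) p \<Longrightarrow>
      metric N p (phi N p u) (phi N p v) = metric N p u v - eta N p u * eta N p v"
proof -
  note * = contact_axioms[THEN spec[of _ p], THEN conjunct2, THEN conjunct2, THEN bspec, OF assms]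
  show "phi N p (phi N p u) = - u + eta N p u *\<^sub>R xi N p" by (rule *[THEN conjunct1])
  show "eta N p u = metric N p u (xi N p)" by (rule *[THEN conjunct2, THEN conjunct2, THEN conjunct1])
  show "metric N p (phi N p u) (phi N p v) = metric N p u v - eta N p u * eta N p v"
    if "v \<in> tangent_space (atlas N) p"
    by (rule *[THEN conjunct2, THEN conjunct2, THEN conjunct2, THEN bspec, OF that])
qed

lemma eta_xi: "eta N p (xi N p) = 1"
  by (rule contact_axioms[THEN spec, THEN conjunct2, THEN conjunct1])

text \<open>Allows \<eta>(a) = 0 to be read off from \<eta>(a) \<xi> = 0.\<close>

lemma xi_nonzero: "xi N p \<noteq> 0"
proof
  assume "xi N p = 0"
  moreover have "linear_from (tangent_space (atlas N) p) (eta N p)"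
    using eta_smooth by (simp add: smooth_one_form_def)
  ultimately show False
    using linear_from_zero[OF _ tangent_subspace[OF atlas_N]] eta_xi[of p] by fastforce
qed

lemma levi_civita_connection: "affine_connection (atlas N) nab"
proof -
  have "levi_civita (atlas N) (metric N) nab"
    using cosymplectic unfolding cosymplectic_manifold_def by (elim conjE)
  then show ?thesis unfolding levi_civita_def by (rule conjunct1)
qed

lemma phi_parallel:
  assumes "smooth_vfield_on (atlas N) U Y" "p \<in> U" "v \<in> tangent_space (atlas N) p"
  shows "nab p v (\<lambda>q. phi N q (Y q)) = phi N p (nab p v Y)"
  using cosymplectic[unfolded cosymplectic_manifold_def, THEN conjunct2, THEN conjunct2, THEN spec, THEN spec,
      THEN mp, OF assms(1), THEN bspec, OF assms(2), THEN bspec, OF assms(3)]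
  by simp

lemma phi_tangent: "u \<in> tangent_space (atlas N) p \<Longrightarrow> phi N p u \<in> tangent_space (atlas N) p"
  by (rule smooth_endomorphism_tangent[OF phi_smooth])

lemma phi_add:
  "u \<in> tangent_space (atlas N) p \<Longrightarrow> v \<in> tangent_space (atlas N) p \<Longrightarrow>
    phi N p (u + v) = phi N p u + phi N p v"
  using smooth_endomorphism_linear[OF phi_smooth] unfolding linear_from_def by blast

lemma atlas_M: "smooth_atlas (satlas M)"
  using immersion unfolding isometric_immersion_def by (elim conjE)

lemma imm_smooth: "smooth_map (satlas M) (atlas N) (imm M)"
  using immersion unfolding isometric_immersion_def by (elim conjE)

lemma dimm_inj: "inj_on (dimm M N p) (Tan M p)"
proof -
  have "\<forall>p. inj_on (dimm M N p) (Tan M p)"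
    using immersion unfolding isometric_immersion_def by (elim conjE)
  then show ?thesis by blast
qed

lemma smetric_eq:
  assumes "u \<in> Tan M p" "v \<in> Tan M p"
  shows "smetric M p u v = ambg M N p (dimm M N p u) (dimm M N p v)"
proof -
  have "\<forall>p. \<forall>u\<in>Tan M p. \<forall>v\<in>Tan M p. smetric M p u v = ambg M N p (dimm M N p u) (dimm M N p v)"
    using immersion unfolding isometric_immersion_def by (elim conjE)
  then show ?thesis using assms by blast
qed

lemma dimm_add: "dimm M N p (u + v) = dimm M N p u + dimm M N p v"
  and dimm_scaleR: "dimm M N p (r *\<^sub>R u) = r *\<^sub>R dimm M N p u"
  using differential_linear[OF atlas_M imm_smooth] unfolding linear_from_def by blast+

lemma dimm_diff: "dimm M N p (u - v) = dimm M N p u - dimm M N p v"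
  using dimm_add[of p u "-1 *\<^sub>R v"] dimm_scaleR[of p "-1" v] by simp

lemma dimm_tangent: "u \<in> Tan M p \<Longrightarrow> dimm M N p u \<in> TN p"
  by (rule differential_tangent[OF atlas_N atlas_M imm_smooth])

lemma metric_linear: "u \<in> tangent_space (atlas N) p \<Longrightarrow> linear_from (tangent_space (atlas N) p) (metric N p u)"
  using metric_N unfolding riemannian_metric_def by blast

lemma metric_commute:
  "u \<in> tangent_space (atlas N) p \<Longrightarrow> v \<in> tangent_space (atlas N) p \<Longrightarrow> metric N p u v = metric N p v u"
  using metric_N unfolding riemannian_metric_def by blast

lemma metric_pos: "u \<in> tangent_space (atlas N) p \<Longrightarrow> u \<noteq> 0 \<Longrightarrow> 0 < metric N p u u"
  using metric_N unfolding riemannian_metric_def by blast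

lemma metric_add_right:
  "u \<in> tangent_space (atlas N) p \<Longrightarrow> v \<in> tangent_space (atlas N) p \<Longrightarrow> w \<in> tangent_space (atlas N) p \<Longrightarrow>
    metric N p u (v + w) = metric N p u v + metric N p u w"
  using metric_linear unfolding linear_from_def by blast

lemma metric_scaleR_right:
  "u \<in> tangent_space (atlas N) p \<Longrightarrow> v \<in> tangent_space (atlas N) p \<Longrightarrow>
    metric N p u (r *\<^sub>R v) = r * metric N p u v"
  using metric_linear unfolding linear_from_def by fastforce

lemma metric_add_left:
  assumes "u \<in> tangent_space (atlas N) p" "v \<in> tangent_space (atlas N) p" "w \<in> tangent_space (atlas N) p"
  shows "metric N p (u + v) w = metric N p u w + metric N p v w"
  using assms metric_add_right[of w p u v] metric_commute[of w p] subspace_add[OF tangent_subspace[OF atlas_N]]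
  by simp

lemma metric_scaleR_left:
  assumes "u \<in> tangent_space (atlas N) p" "w \<in> tangent_space (atlas N) p"
  shows "metric N p (r *\<^sub>R u) w = r * metric N p u w"
  using assms metric_scaleR_right[of w p u r] metric_commute[of w p] subspace_scale[OF tangent_subspace[OF atlas_N]]
  by simp

lemma metric_zero_left: "w \<in> tangent_space (atlas N) p \<Longrightarrow> metric N p 0 w = 0"
  using metric_scaleR_left[of w p w 0] by simp

lemma metric_diff_left:
  assumes "u \<in> tangent_space (atlas N) p" "v \<in> tangent_space (atlas N) p" "w \<in> tangent_space (atlas N) p"
  shows "metric N p (u - v) w = metric N p u w - metric N p v w"
  using metric_add_left[of u p "-1 *\<^sub>R v" w] metric_scaleR_left[of v p w "-1"] assms
    subspace_scale[OF tangent_subspace[OF atlas_N], of v p "-1"]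
  by simp

text \<open>The orthogonal projection is obtained from the Gram operator of the pulled-back inner product,
  which is injective, hence surjective.\<close>

lemma orthogonal_projection_ex:
  assumes w: "w \<in> TN p"
  obtains u where "u \<in> Tan M p" "\<And>z. z \<in> Tan M p \<Longrightarrow> ambg M N p (w - dimm M N p u) (dimm M N p z) = 0"
proof -
  obtain d where d: "d \<in> charts_at (satlas M) p" using charts_at_ex[OF atlas_M] .
  \<comment> \<open>The chart identifies the model space with the tangent space of M at p, so that
    surjectivity of an injective linear endomorphism can be used in a Euclidean space.\<close>
  define e where "e = (\<lambda>x. coord_vec (satlas M) d x p)"
  define L where "L = (\<lambda>x. dimm M N p (e x))"
  note subT = tangent_subspace[OF atlas_M, of p]
  have e: "e x \<in> Tan M p" for x unfolding e_def by (rule coord_vec_tangent[OF atlas_M d])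
  have comp_e: "comp (e x) d = x" for x unfolding e_def by (rule comp_coord_vec_self[OF atlas_M d])
  have e_comp: "e (comp u d) = u" if "u \<in> Tan M p" for u
    by (rule tangent_eqI[OF e that d comp_e])
  have "e (x + y) = e x + e y" for x y
    by (rule tangent_eqI[OF e subspace_add[OF subT e e] d]) (simp add: comp_e)
  moreover have "e (r *\<^sub>R x) = r *\<^sub>R e x" for r x
    by (rule tangent_eqI[OF e subspace_scale[OF subT e] d]) (simp add: comp_e)
  ultimately have lin: "linear L"
    by (intro linearI) (simp_all add: L_def dimm_add dimm_scaleR)
  have L: "L x \<in> TN p" for x unfolding L_def by (rule dimm_tangent[OF e])
  have L0: "x = 0" if "L x = 0" for x
  proof -
    have "dimm M N p (e x) = dimm M N p (e 0)"
      using that linear_0[OF lin] by (simp add: L_def)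
    then have "e x = e 0" by (rule inj_onD[OF dimm_inj _ e e])
    then show ?thesis by (metis comp_e)
  qed
  \<comment> \<open>\<open>G w\<close> represents the functional that sends y to g(w, L y) by the
    Euclidean inner product. Hence w - L x is orthogonal to M exactly if G w = G (L x), and G (L x)
    = 0 forces g(L x, L x) = 0.\<close>
  define G where "G = (\<lambda>w. \<Sum>b\<in>Basis. metric N (imm M p) w (L b) *\<^sub>R b)"
  have G: "G w \<bullet> y = metric N (imm M p) w (L y)" if "w \<in> TN p" for w y
  proof -
    have "metric N (imm M p) w (L y) = metric N (imm M p) w (\<Sum>b\<in>Basis. (y \<bullet> b) *\<^sub>R L b)"
      using linear_euclidean_expand[OF lin, of y] by simp
    also have "\<dots> = (\<Sum>b\<in>Basis. (y \<bullet> b) *\<^sub>R metric N (imm M p) w (L b))"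
      by (rule linear_from_scaled_sum[OF metric_linear[OF that] tangent_subspace[OF atlas_N] L])
    finally show ?thesis
      by (simp add: G_def inner_sum_left inner_commute[of y] mult.commute)
  qed
  have "linear (\<lambda>x. G (L x))"
    by (rule linearI)
      (simp_all add: G_def linear_add[OF lin] linear_scale[OF lin] metric_add_left metric_scaleR_left L
        scaleR_add_left sum.distrib scaleR_sum_right)
  moreover have "x = 0" if "G (L x) = 0" for x
    using G[OF L, of x x] metric_pos[OF L, of x] L0[of x] that by fastforce
  ultimately have "surj (\<lambda>x. G (L x))"
    using linear_injective_imp_surjective linear_injective_0 by blast
  then obtain x where x: "G w = G (L x)" by (metis surjD)
  show ?thesis
  proof (rule that[OF e[of x]])
    fix z assume z: "z \<in> Tan M p"
    have "metric N (imm M p) w (L (comp z d)) = metric N (imm M p) (L x) (L (comp z d))"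
      using G[OF w, of "comp z d"] G[OF L, of x "comp z d"] x by simp
    then show "ambg M N p (w - dimm M N p (e x)) (dimm M N p z) = 0"
      using metric_diff_left[OF w L[of x] L[of "comp z d"]] by (simp add: L_def e_comp[OF z])
  qed
qed

text \<open>The difference of two candidates is tangent and, by subtracting the two orthogonality
  relations, orthogonal to itself. Positivity of the metric kills its image, and the differential of
  the immersion is injective.\<close>

lemma tan_part_eqI:
  assumes w: "w \<in> TN p" and u: "u \<in> Tan M p"
    and orth: "\<And>z. z \<in> Tan M p \<Longrightarrow> ambg M N p (w - dimm M N p u) (dimm M N p z) = 0"
  shows "tan_part M N p w = u"
  unfolding tan_part_def
proof (rule the_equality)
  show "u \<in> Tan M p \<and> (\<forall>z\<in>Tan M p. ambg M N p (w - dimm M N p u) (dimm M N p z) = 0)"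
    using u orth by blast
  fix u' assume u': "u' \<in> Tan M p \<and> (\<forall>z\<in>Tan M p. ambg M N p (w - dimm M N p u') (dimm M N p z) = 0)"
  then have uu': "u' - u \<in> Tan M p" by (intro subspace_diff[OF tangent_subspace[OF atlas_M]] u) simp
  note TN = dimm_tangent[OF u] dimm_tangent[OF u'[THEN conjunct1]] dimm_tangent[OF uu']
  have "ambg M N p (dimm M N p (u' - u)) (dimm M N p (u' - u)) =
      ambg M N p (w - dimm M N p u) (dimm M N p (u' - u)) - ambg M N p (w - dimm M N p u') (dimm M N p (u' - u))"
    using metric_diff_left[OF w TN(1) TN(3)] metric_diff_left[OF w TN(2) TN(3)]
      metric_diff_left[OF TN(2) TN(1) TN(3)] by (simp add: dimm_diff)
  also have "\<dots> = 0" using orth uu' u' by simp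
  finally have "dimm M N p (u' - u) = 0" using metric_pos[OF TN(3)] by fastforce
  then have "dimm M N p u' = dimm M N p u" by (simp add: dimm_diff)
  then show "u' = u" using u u' by (meson dimm_inj inj_onD)
qed

lemma tan_part_decomp:
  assumes w: "w \<in> TN p"
  shows tan_part_tangent: "tan_part M N p w \<in> Tan M p"
    and nor_part_tangent: "nor_part M N p w \<in> TN p"
    and nor_part_orthogonal: "z \<in> Tan M p \<Longrightarrow> ambg M N p (nor_part M N p w) (dimm M N p z) = 0"
proof -
  obtain u where u: "u \<in> Tan M p" "\<And>z. z \<in> Tan M p \<Longrightarrow> ambg M N p (w - dimm M N p u) (dimm M N p z) = 0"
    using orthogonal_projection_ex[OF w] by blast
  have "tan_part M N p w = u" by (rule tan_part_eqI[OF w u])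
  with u show "tan_part M N p w \<in> Tan M p"
    and "z \<in> Tan M p \<Longrightarrow> ambg M N p (nor_part M N p w) (dimm M N p z) = 0"
    and "nor_part M N p w \<in> TN p"
    using subspace_diff[OF tangent_subspace[OF atlas_N] w dimm_tangent[OF u(1)]]
    by (simp_all add: nor_part_def)
qed

lemma tan_nor_sum: "dimm M N p (tan_part M N p w) + nor_part M N p w = w"
  by (simp add: nor_part_def)

lemma tan_part_dimm: "u \<in> Tan M p \<Longrightarrow> tan_part M N p (dimm M N p u) = u"
  by (rule tan_part_eqI[OF dimm_tangent]) (auto simp: metric_zero_left dimm_tangent)

lemma nor_part_add:
  assumes "v \<in> TN p" "w \<in> TN p"
  shows "nor_part M N p (v + w) = nor_part M N p v + nor_part M N p w"
proof -
  have vw: "v + w \<in> TN p" by (intro subspace_add tangent_subspace[OF atlas_N] assms)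
  have "tan_part M N p (v + w) = tan_part M N p v + tan_part M N p w"
  proof (rule tan_part_eqI[OF vw])
    show "tan_part M N p v + tan_part M N p w \<in> Tan M p"
      by (intro subspace_add tangent_subspace[OF atlas_M] tan_part_tangent assms)
    fix z assume z: "z \<in> Tan M p"
    have "v + w - dimm M N p (tan_part M N p v + tan_part M N p w) = nor_part M N p v + nor_part M N p w"
      by (simp add: nor_part_def dimm_add)
    then show "ambg M N p (v + w - dimm M N p (tan_part M N p v + tan_part M N p w)) (dimm M N p z) = 0"
      using metric_add_left[OF nor_part_tangent[OF assms(1)] nor_part_tangent[OF assms(2)] dimm_tangent[OF z]]
        nor_part_orthogonal[OF assms(1) z] nor_part_orthogonal[OF assms(2) z] by simp
  qed
  then show ?thesis by (simp add: nor_part_def dimm_add)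
qed

text \<open>The mixed terms vanish by orthogonality. For b = \<nabla>_X TY the right-hand side
  collects both sides of the metric condition, which therefore says that g(b, \<phi>z) = 0.\<close>

lemma metric_phi_split:
  assumes b: "b \<in> TN p" and z: "z \<in> Tan M p"
  shows "ambg M N p b (phi N (imm M p) (dimm M N p z)) =
    smetric M p (tan_part M N p b) (TT M N p z) + ambg M N p (nor_part M N p b) (FF M N p z)"
proof -
  let ?w = "phi N (imm M p) (dimm M N p z)"
  have w: "?w \<in> TN p" by (intro phi_tangent dimm_tangent z)
  note b' = dimm_tangent[OF tan_part_tangent[OF b]] nor_part_tangent[OF b]
  note w' = dimm_tangent[OF tan_part_tangent[OF w]] nor_part_tangent[OF w]
  have "ambg M N p b ?w = ambg M N p (dimm M N p (tan_part M N p b) + nor_part M N p b)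
      (dimm M N p (tan_part M N p ?w) + nor_part M N p ?w)"
    by (simp add: tan_nor_sum)
  also have "\<dots> = ambg M N p (dimm M N p (tan_part M N p b)) (dimm M N p (tan_part M N p ?w)) +
      ambg M N p (nor_part M N p b) (nor_part M N p ?w)"
    using nor_part_orthogonal[OF b tan_part_tangent[OF w]] nor_part_orthogonal[OF w tan_part_tangent[OF b]]
      metric_commute[OF b'(1) w'(2)] subspace_add[OF tangent_subspace[OF atlas_N] w']
    by (simp add: metric_add_left metric_add_right b' w')
  finally show ?thesis
    by (simp add: TT_def FF_def smetric_eq tan_part_tangent b w)
qed

text \<open>For b = \<nabla>_X TY the right-hand side is the vector in the normal condition, which
  is thereby recognised as the normal part of \<phi>b.\<close>

lemma nor_part_phi:
  assumes b: "b \<in> TN p"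
  shows "nor_part M N p (phi N (imm M p) b) = FF M N p (tan_part M N p b) + CC M N p (nor_part M N p b)"
proof -
  note b' = dimm_tangent[OF tan_part_tangent[OF b]] nor_part_tangent[OF b]
  have "phi N (imm M p) b =
      phi N (imm M p) (dimm M N p (tan_part M N p b)) + phi N (imm M p) (nor_part M N p b)"
    using phi_add[OF b'] by (simp add: tan_nor_sum)
  then show ?thesis
    by (simp add: FF_def CC_def nor_part_add phi_tangent b')
qed

lemma amb_conn_tangent: "X p \<in> Tan M p \<Longrightarrow> amb_conn M N nab X Y p \<in> TN p"
  unfolding amb_conn_def
  by (rule cov_along_tangent[OF atlas_N atlas_M imm_smooth levi_civita_connection])

end

section \<open>Ambient derivatives of sections of an invariant horizontal distribution\<close>

locale invariant_distribution = cosymplectic_immersion N nab M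
  for N :: "('m::{t2_space, second_countable_topology}, 'e::euclidean_space) contact_structure"
    and nab :: "('m, 'e) connection"
    and M :: "('n::{t2_space, second_countable_topology}, 'd::euclidean_space, 'm) immersed" +
  fixes D :: "'n \<Rightarrow> ('n, 'd) tvec set"
  assumes D_tangent: "D p \<subseteq> Tan M p"
    and D_invariant: "phi N (imm M p) ` dimm M N p ` D p \<subseteq> dimm M N p ` D p"
    and D_horizontal: "u \<in> D p \<Longrightarrow> eta N (imm M p) (dimm M N p u) = 0"
begin

lemma dimm_TT: "u \<in> D p \<Longrightarrow> dimm M N p (TT M N p u) = phi N (imm M p) (dimm M N p u)"
proof -
  assume "u \<in> D p"
  then obtain u' where "u' \<in> D p" "phi N (imm M p) (dimm M N p u) = dimm M N p u'"
    using D_invariant by blast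
  then show ?thesis using tan_part_dimm[of u' p] D_tangent[of p] by (auto simp: TT_def)
qed

lemma amb_conn_section:
  assumes X: "X p \<in> Tan M p" and Y: "Y \<in> sections (satlas M) D"
  shows amb_conn_TT: "amb_conn M N nab X (\<lambda>q. TT M N q (Y q)) p = phi N (imm M p) (amb_conn M N nab X Y p)"
    and phi_phi_amb_conn: "phi N (imm M p) (phi N (imm M p) (amb_conn M N nab X Y p)) = - amb_conn M N nab X Y p"
    and eta_amb_conn: "eta N (imm M p) (amb_conn M N nab X Y p) = 0"
proof -
  let ?cov = "cov_along (satlas M) (atlas N) nab (imm M) p (X p)"
  let ?phi = "\<lambda>V q. phi N (imm M q) (V q)"
  define V where "V = (\<lambda>q. dimm M N q (Y q))"
  have YD: "Y q \<in> D q" for q using Y by (simp add: sections_def)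
  then have V: "V q \<in> TN q" for q unfolding V_def using D_tangent by (intro dimm_tangent) blast
  have Ys: "smooth_vfield_on (satlas M) UNIV Y" using Y by (simp add: sections_def)
  have dV: "tdifferentiable (satlas M) p (\<lambda>q. comp (V q) c)" if "c \<in> charts_at (atlas N) (imm M p)" for c
    unfolding V_def
    by (rule differential_vfield_tdifferentiable[OF atlas_N atlas_M imm_smooth Ys UNIV_I that])
  have cov_phi: "?cov (?phi W) = phi N (imm M p) (?cov W)"
    if "\<And>q. W q \<in> TN q"
      and "\<And>c. c \<in> charts_at (atlas N) (imm M p) \<Longrightarrow> tdifferentiable (satlas M) p (\<lambda>q. comp (W q) c)" for W
    using that
    by (intro cov_along_parallel_endomorphism[OF atlas_N atlas_M imm_smooth levi_civita_connection phi_smooth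
          phi_parallel _ _ X])
  have a: "amb_conn M N nab X Y p = ?cov V" by (simp add: amb_conn_def V_def)
  have 1: "?cov (?phi V) = phi N (imm M p) (?cov V)" by (rule cov_phi[OF V dV])
  \<comment> \<open>Here the differentiated field is \<phi>V along the immersion; differentiability
    of its components at p comes from those of V and of \<phi>.\<close>
  have "?cov (?phi (?phi V)) = phi N (imm M p) (?cov (?phi V))"
    by (intro cov_phi phi_tangent V
        tdifferentiable_endomorphism_along[OF atlas_N atlas_M imm_smooth phi_smooth V dV])
  moreover have "?phi (?phi V) q = - V q" for q
    using phi_phi[OF V] D_horizontal[OF YD] by (simp add: V_def)
  moreover have "?cov (\<lambda>q. - V q) = - ?cov V"
    by (rule cov_along_uminus[OF atlas_N atlas_M X dV])
  ultimately show 2: "phi N (imm M p) (phi N (imm M p) (amb_conn M N nab X Y p)) = - amb_conn M N nab X Y p"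
    using 1 a by simp
  show "amb_conn M N nab X (\<lambda>q. TT M N q (Y q)) p = phi N (imm M p) (amb_conn M N nab X Y p)"
    using 1 by (simp add: amb_conn_def V_def dimm_TT YD)
  \<comment> \<open>Compare \<phi>(\<phi>a) = -a with the structure identity \<phi>(\<phi>a) = -a +
    \<eta>(a) \<xi> and cancel the nonzero \<xi>.\<close>
  show "eta N (imm M p) (amb_conn M N nab X Y p) = 0"
    using phi_phi[OF amb_conn_tangent[of X p Y, OF X]] 2 xi_nonzero by simp
qed

text \<open>Both equivalences live at a single point, with z an arbitrary tangent vector; passing
  between vectors and sections is left to the theorem. They rest on b = \<phi>a and \<phi>b = -a for
  the derivative b of TY, and on \<eta>(a) = 0, by which \<phi> preserves the inner product of a
  with z.\<close>

lemma conditions_iff: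
  assumes X: "X p \<in> Tan M p" and Y: "Y \<in> sections (satlas M) D"
  defines "TY \<equiv> (\<lambda>q. TT M N q (Y q))" and "a \<equiv> amb_conn M N nab X Y p"
  shows metric_condition_iff: "z \<in> Tan M p \<Longrightarrow>
      smetric M p (ind_conn M N nab X TY p) (TT M N p z) = - ambg M N p (sff M N nab X TY p) (FF M N p z) \<longleftrightarrow>
      ambg M N p a (dimm M N p z) = 0"
    and normal_condition_iff:
      "FF M N p (ind_conn M N nab X TY p) + CC M N p (sff M N nab X TY p) = 0 \<longleftrightarrow> nor_part M N p a = 0"
proof -
  let ?b = "amb_conn M N nab X TY p"
  have a: "a \<in> TN p" unfolding a_def using X by (rule amb_conn_tangent)
  have ba: "?b = phi N (imm M p) a" unfolding TY_def a_def by (rule amb_conn_TT[of X p Y, OF X Y])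
  have b: "?b \<in> TN p" using X by (rule amb_conn_tangent)
  {
    assume z: "z \<in> Tan M p"
    have "ambg M N p ?b (phi N (imm M p) (dimm M N p z)) = ambg M N p a (dimm M N p z)"
      unfolding ba using metric_phi[OF a dimm_tangent[OF z]] eta_amb_conn[of X p Y, OF X Y] by (simp add: a_def)
    then show "smetric M p (ind_conn M N nab X TY p) (TT M N p z) =
        - ambg M N p (sff M N nab X TY p) (FF M N p z) \<longleftrightarrow> ambg M N p a (dimm M N p z) = 0"
      using metric_phi_split[OF b z] by (auto simp: ind_conn_def sff_def)
  }
  have na: "- a \<in> TN p" using subspace_neg[OF tangent_subspace[OF atlas_N] a] .
  have "phi N (imm M p) ?b = - a"
    unfolding ba using phi_phi_amb_conn[of X p Y, OF X Y] by (simp add: a_def)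
  then have "FF M N p (ind_conn M N nab X TY p) + CC M N p (sff M N nab X TY p) = nor_part M N p (- a)"
    using nor_part_phi[OF b] by (simp add: ind_conn_def sff_def)
  \<comment> \<open>Additivity at a + (-a) and at 0 + 0 together give that the normal part is odd,
    so those of a and -a vanish simultaneously.\<close>
  moreover have "nor_part M N p a + nor_part M N p (- a) = nor_part M N p (a + - a)"
    by (rule nor_part_add[OF a na, symmetric])
  moreover have "nor_part M N p (0 + 0) = nor_part M N p 0 + nor_part M N p 0"
    by (intro nor_part_add subspace_0 tangent_subspace[OF atlas_N])
  ultimately show "FF M N p (ind_conn M N nab X TY p) + CC M N p (sff M N nab X TY p) = 0 \<longleftrightarrow>
      nor_part M N p a = 0"
    by (auto simp: add_eq_0_iff)
qed

end

section \<open>Total geodesy of the invariant distribution\<close>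

theorem theorem4p4:
  fixes N :: "('m::{t2_space, second_countable_topology}, 'e::euclidean_space) contact_structure"
    and nab :: "('m, 'e) connection"
    and M :: "('n::{t2_space, second_countable_topology}, 'd::euclidean_space, 'm) immersed"
    and D D1 D2 :: "'n \<Rightarrow> ('n, 'd) tvec set"
    and \<theta>1 \<theta>2 :: real
  assumes "cosymplectic_manifold N nab"
    and "proper_quasi_bi_slant M N D D1 D2 \<theta>1 \<theta>2"
  shows "totally_geodesic_foliation M N nab D \<longleftrightarrow>
    (\<forall>X\<in>sections (satlas M) D. \<forall>Y\<in>sections (satlas M) D.
     \<forall>Z\<in>sections (satlas M) (dist_sum D1 D2).
       let TY = (\<lambda>p. TT M N p (Y p)) in
       (\<forall>p. smetric M p (ind_conn M N nab X TY p) (TT M N p (Z p)) =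
            - metric N (imm M p) (sff M N nab X TY p) (FF M N p (Z p))) \<and>
       (\<forall>p. FF M N p (ind_conn M N nab X TY p) + CC M N p (sff M N nab X TY p) = 0))"
proof -
  obtain r r1 r2 where q: "quasi_bi_slant M N r r1 r2 D D1 D2 \<theta>1 \<theta>2"
    using assms(2) unfolding proper_quasi_bi_slant_def by blast
  have imm: "isometric_immersion M N"
    using q unfolding quasi_bi_slant_def by (elim conjE)
  interpret cosymplectic_immersion N nab M
    using assms(1) imm by unfold_locales
  have xi: "\<forall>p. xi N (imm M p) \<in> dimm M N p ` Tan M p"
    using q unfolding quasi_bi_slant_def by (elim conjE)
  have dist: "distribution (satlas M) r D" "distribution (satlas M) r1 D1" "distribution (satlas M) r2 D2"
    using q unfolding quasi_bi_slant_def by (simp_all only:)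
  have orth: "orthogonal_dist M D D1" "orthogonal_dist M D D2"
    "orthogonal_dist M D (reeb_line M N)"
    using q unfolding quasi_bi_slant_def by (simp_all only:)
  have Tan_eq: "\<forall>p. Tan M p = dist_sum (dist_sum (dist_sum D D1) D2) (reeb_line M N) p"
    using q unfolding quasi_bi_slant_def by (elim conjE)
  have inv: "\<forall>p. phi N (imm M p) ` dimm M N p ` D p = dimm M N p ` D p"
    using q unfolding quasi_bi_slant_def by (elim conjE)
  have sub: "subspace (D p)" "subspace (D1 p)" "subspace (D2 p)" for p
    using dist by (simp_all add: distribution_def)
  have tan: "D p \<subseteq> Tan M p" "D1 p \<subseteq> Tan M p" "D2 p \<subseteq> Tan M p" for p
    using dist by (simp_all add: distribution_def)
  have eta_D: "eta N (imm M p) (dimm M N p u) = 0" if u: "u \<in> D p" for u p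
  proof -
    \<comment> \<open>\<xi> is tangent to M, so it is the image of a vector of
      \<open>reeb_line\<close>, to which \<open>D\<close> is orthogonal; and \<eta>(u) = g(u,
      \<xi>).\<close>
    obtain x where x: "x \<in> Tan M p" "xi N (imm M p) = dimm M N p x" using xi by blast
    then have "x \<in> reeb_line M N p" by (auto simp: reeb_line_def intro: span_base)
    then have "smetric M p u x = 0" using orth(3) u by (simp add: orthogonal_dist_def)
    moreover have uT: "u \<in> Tan M p" using u tan by blast
    ultimately show ?thesis
      using eta_eq_metric[OF dimm_tangent[OF uT]] smetric_eq[OF uT x(1)] x(2) by simp
  qed
  interpret invariant_distribution N nab M D
    using tan inv eta_D by unfold_locales auto
  \<comment> \<open>Membership in \<open>D\<close> is turned into the two vanishing statements of
    \<open>conditions_iff\<close>; orthogonality to \<xi> is already contained in \<eta>(a) =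
    0.\<close>
  have in_D_iff: "a \<in> dimm M N p ` D p \<longleftrightarrow>
      nor_part M N p a = 0 \<and> (\<forall>z \<in> D1 p \<union> D2 p. ambg M N p a (dimm M N p z) = 0)"
    if a: "a \<in> TN p" and eta: "eta N (imm M p) a = 0" for a p
  proof
    assume "a \<in> dimm M N p ` D p"
    then obtain u where u: "u \<in> D p" "a = dimm M N p u" by blast
    have uT: "u \<in> Tan M p" using u tan by blast
    have "nor_part M N p a = 0" by (simp add: nor_part_def u(2) tan_part_dimm[OF uT])
    moreover have "ambg M N p a (dimm M N p z) = 0" if z: "z \<in> D1 p \<union> D2 p" for z
    proof -
      have "z \<in> Tan M p" using z tan by blast
      moreover have "smetric M p u z = 0" using z u orth by (auto simp: orthogonal_dist_def)
      ultimately show ?thesis using smetric_eq[OF uT] u by simp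
    qed
    ultimately show "nor_part M N p a = 0 \<and> (\<forall>z \<in> D1 p \<union> D2 p. ambg M N p a (dimm M N p z) = 0)"
      by blast
  next
    assume "nor_part M N p a = 0 \<and> (\<forall>z \<in> D1 p \<union> D2 p. ambg M N p a (dimm M N p z) = 0)"
    then have nor: "nor_part M N p a = 0" and az: "\<And>z. z \<in> D1 p \<union> D2 p \<Longrightarrow> ambg M N p a (dimm M N p z) = 0"
      by auto
    define u where "u = tan_part M N p a"
    have uT: "u \<in> Tan M p" unfolding u_def by (rule tan_part_tangent[OF a])
    have au: "a = dimm M N p u" using tan_nor_sum[of p a] nor by (simp add: u_def)
    have "u \<in> dist_sum (dist_sum (dist_sum D D1) D2) (reeb_line M N) p"
      using uT Tan_eq by blast
    then obtain d d1 d2 e where u: "u = d + d1 + d2 + e" and d: "d \<in> D p" "d1 \<in> D1 p" "d2 \<in> D2 p"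
      and e: "e \<in> reeb_line M N p"
      unfolding dist_sum_def by auto
    have dT: "d \<in> Tan M p" "d1 \<in> Tan M p" "d2 \<in> Tan M p" and eT: "e \<in> Tan M p"
      using d tan[of p] e by (auto simp: reeb_line_def)
    obtain k where k: "dimm M N p e = k *\<^sub>R xi N (imm M p)"
      using e unfolding reeb_line_def span_singleton by blast
    \<comment> \<open>w is the part of a outside \<open>D\<close>, a sum of vectors from
      \<open>D1\<close>, \<open>D2\<close> and the line of \<xi>. Both a and its
      \<open>D\<close>-component are orthogonal to all three, so their difference w is orthogonal to
      itself and vanishes.\<close>
    define w where "w = dimm M N p (u - d)"
    have ud: "u - d = d1 + d2 + e" by (simp add: u)
    have wT: "w \<in> TN p"
      unfolding w_def by (intro dimm_tangent subspace_diff[OF tangent_subspace[OF atlas_M]] uT dT)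
    have w: "w = dimm M N p d1 + dimm M N p d2 + dimm M N p e"
      unfolding w_def ud by (simp add: dimm_add)
    have a_e: "ambg M N p x (dimm M N p e) = 0" if "x \<in> TN p" "eta N (imm M p) x = 0" for x
      using that metric_scaleR_right[OF that(1) xi_tangent] eta_eq_metric[OF that(1)] by (simp add: k)
    have sum_T: "dimm M N p d1 + dimm M N p d2 \<in> TN p"
      by (intro subspace_add tangent_subspace[OF atlas_N] dimm_tangent dT)
    \<comment> \<open>Stated for general x because it is used twice: for a itself and for the
      \<open>D\<close>-component of a.\<close>
    have "ambg M N p x w = 0"
      if x: "x \<in> TN p" "eta N (imm M p) x = 0" "ambg M N p x (dimm M N p d1) = 0" "ambg M N p x (dimm M N p d2) = 0"
      for x
      using metric_add_right[OF x(1) sum_T dimm_tangent[OF eT]]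
        metric_add_right[OF x(1) dimm_tangent[OF dT(2)] dimm_tangent[OF dT(3)]] a_e[OF x(1,2)] x(3,4)
      by (simp add: w)
    moreover have "ambg M N p (dimm M N p d) (dimm M N p d1) = 0" "ambg M N p (dimm M N p d) (dimm M N p d2) = 0"
      using orth d smetric_eq[OF dT(1,2)] smetric_eq[OF dT(1,3)] by (auto simp: orthogonal_dist_def)
    ultimately have "ambg M N p a w = 0" "ambg M N p (dimm M N p d) w = 0"
      using a eta az d dimm_tangent[OF dT(1)] eta_D[OF d(1)] by auto
    then have "ambg M N p w w = 0"
      using metric_diff_left[OF a dimm_tangent[OF dT(1)] wT] au by (simp add: w_def dimm_diff)
    then have "w = 0" using metric_pos[OF wT] by fastforce
    then have "a = dimm M N p d" by (simp add: w_def dimm_diff au)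
    then show "a \<in> dimm M N p ` D p" using d by blast
  qed
  have sections_D: "X p \<in> Tan M p" if "X \<in> sections (satlas M) D" for X p
    using that tan[of p] by (auto simp: sections_def)
  show ?thesis
    unfolding Let_def totally_geodesic_foliation_def
  proof (intro iffI ballI allI conjI)
    fix X Y Z p
    assume tg: "\<forall>X\<in>sections (satlas M) D. \<forall>Y\<in>sections (satlas M) D. \<forall>p. amb_conn M N nab X Y p \<in> dimm M N p ` D p"
      and X: "X \<in> sections (satlas M) D" and Y: "Y \<in> sections (satlas M) D"
      and Z: "Z \<in> sections (satlas M) (dist_sum D1 D2)"
    let ?a = "amb_conn M N nab X Y p"
    note XT = sections_D[OF X, of p]
    have aT: "?a \<in> TN p" using XT by (rule amb_conn_tangent)
    have a: "nor_part M N p ?a = 0" "\<And>z. z \<in> D1 p \<union> D2 p \<Longrightarrow> ambg M N p ?a (dimm M N p z) = 0"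
      using in_D_iff[OF aT eta_amb_conn[of X p Y, OF XT Y]] tg X Y by blast+
    show "FF M N p (ind_conn M N nab X (\<lambda>p. TT M N p (Y p)) p) + CC M N p (sff M N nab X (\<lambda>p. TT M N p (Y p)) p) = 0"
      using normal_condition_iff[of X p Y, OF XT Y] a(1) by simp
    have "Z p \<in> dist_sum D1 D2 p" using Z by (simp add: sections_def)
    then obtain z1 z2 where z: "Z p = z1 + z2" "z1 \<in> D1 p" "z2 \<in> D2 p"
      by (auto simp: dist_sum_def)
    have zT: "z1 \<in> Tan M p" "z2 \<in> Tan M p" using z tan by blast+
    have "ambg M N p ?a (dimm M N p (Z p)) = 0"
      using a(2) z metric_add_right[OF aT dimm_tangent[OF zT(1)] dimm_tangent[OF zT(2)]] by (simp add: dimm_add)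
    moreover have "Z p \<in> Tan M p" using subspace_add[OF tangent_subspace[OF atlas_M] zT] z by simp
    ultimately show "smetric M p (ind_conn M N nab X (\<lambda>p. TT M N p (Y p)) p) (TT M N p (Z p)) =
        - ambg M N p (sff M N nab X (\<lambda>p. TT M N p (Y p)) p) (FF M N p (Z p))"
      using metric_condition_iff[of X p Y, OF XT Y] by simp
  next
    fix X Y p
    assume cond: "\<forall>X\<in>sections (satlas M) D. \<forall>Y\<in>sections (satlas M) D.
        \<forall>Z\<in>sections (satlas M) (dist_sum D1 D2).
        (\<forall>p. smetric M p (ind_conn M N nab X (\<lambda>p. TT M N p (Y p)) p) (TT M N p (Z p)) =
          - ambg M N p (sff M N nab X (\<lambda>p. TT M N p (Y p)) p) (FF M N p (Z p))) \<and>
        (\<forall>p. FF M N p (ind_conn M N nab X (\<lambda>p. TT M N p (Y p)) p) +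
          CC M N p (sff M N nab X (\<lambda>p. TT M N p (Y p)) p) = 0)"
      and X: "X \<in> sections (satlas M) D" and Y: "Y \<in> sections (satlas M) D"
    let ?a = "amb_conn M N nab X Y p"
    note XT = sections_D[OF X, of p]
    have aT: "?a \<in> TN p" using XT by (rule amb_conn_tangent)
    \<comment> \<open>The zero vector of the other summand makes a section of \<open>D1\<close> or
      \<open>D2\<close> a section of the sum, so it suffices to extend vectors within one summand,
      and no local frame of \<open>dist_sum D1 D2\<close> has to be built.\<close>
    have sum1: "sections (satlas M) D1 \<subseteq> sections (satlas M) (dist_sum D1 D2)"
      using subspace_0[OF sub(3)] unfolding sections_def dist_sum_def by force
    have sum2: "sections (satlas M) D2 \<subseteq> sections (satlas M) (dist_sum D1 D2)"
      using subspace_0[OF sub(2)] unfolding sections_def dist_sum_def by force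
    have orthogonal: "ambg M N p ?a (dimm M N p z) = 0" if z: "z \<in> D1 p \<union> D2 p" for z
    proof -
      obtain Z where Z: "Z \<in> sections (satlas M) (dist_sum D1 D2)" "Z p = z"
        using z section_through[OF atlas_M dist(2)] section_through[OF atlas_M dist(3)] sum1 sum2
        by (metis UnE subsetD)
      have "z \<in> Tan M p" using z tan by blast
      then show ?thesis
        using metric_condition_iff[of X p Y z, OF XT Y] cond X Y Z by blast
    qed
    \<comment> \<open>The normal condition also stands under the quantifier over Z, although Z does
      not occur in it, so some section must be supplied; one through the zero vector of
      \<open>D1\<close> at p is available.\<close>
    obtain Z where "Z \<in> sections (satlas M) (dist_sum D1 D2)"
      using section_through[OF atlas_M dist(2) subspace_0[OF sub(2)]] sum1 by blast
    then have "nor_part M N p ?a = 0"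
      using normal_condition_iff[of X p Y, OF XT Y] cond X Y by blast
    then show "?a \<in> dimm M N p ` D p"
      using in_D_iff[OF aT eta_amb_conn[of X p Y, OF XT Y]] orthogonal by blast
  qed
qed

end
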